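(* Let $(V,\langle\,,\,\rangle)$ be a real vector space with a metric of signature $(2,n)$, $n\geq 2$, and let $\mathrm{K}$ be a semi-symmetric curvature tensor on $V$. Then the Ricci operator $\mathrm{Ric}_{\mathrm K}$ admits at most two non-real eigenvalues. Let $\alpha_1,\ldots,\alpha_r$ be the distinct non-zero real eigenvalues of $\mathrm{Ric}_{\mathrm K}$ and $V_1,\ldots,V_r$ the corresponding eigenspaces. Then one of the following holds: 1. $\mathrm{Ric}_{\mathrm K}$ has two non-real eigenvalues $z$ and $\bar z$, and $V$ splits orthogonally as $$V=V_c\oplus V_0\oplus V_1\oplus\cdots\oplus V_r,$$ where $V_0=\ker(\mathrm{Ric}_{\mathrm K})$ and $V_c=\ker\big(\mathrm{Ric}_{\mathrm K}^2-(z+\bar z)\mathrm{Ric}_{\mathrm K}+|z|^2\,\mathrm{Id}_V\big)$. Moreover $\dim V_c=4$ and, for every $i\geq 0$, $V_i$ is a Riemannian semi-symmetric space (i.e. the metric is positive definite on $V_i$ and $\mathrm{K}$ restricts to a semi-symmetric curvature tensor on $V_i$). 2. $\mathrm{Ric}_{\mathrm K}$ has only real eigenvalues, and $V$ splits orthogonally as $$V=V_0\oplus V_1\oplus\cdots\oplus V_r,\qquad\text{where } V_0=\ker(\mathrm{Ric}_{\mathrm K}^2).$$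
   Context: Signature $(2,n)$ means two negative and $n$ positive directions. For $u,v\in V$, $u\wedge v$ denotes the skew-symmetric endomorphism $(u\wedge v)w=\langle v,w\rangle u-\langle u,w\rangle v$; this identifies $V\wedge V$ with $\mathrm{so}(V,\langle\,,\,\rangle)$. The space $V\wedge V$ carries the nondegenerate symmetric product $\langle u\wedge v,w\wedge t\rangle=\langle v,w\rangle\langle u,t\rangle-\langle u,w\rangle\langle v,t\rangle$. A curvature tensor on $V$ is a symmetric (with respect to this product) endomorphism $\mathrm K$ of $V\wedge V$, written $\mathrm K(u,v)=\mathrm K(u\wedge v)\in\mathrm{so}(V)$, satisfying the Bianchi identity $\mathrm K(u,v)w+\mathrm K(v,w)u+\mathrm K(w,u)v=0$. It is semi-symmetric if $[\mathrm K(u,v),\mathrm K(a,b)]=\mathrm K(\mathrm K(u,v)a,b)+\mathrm K(a,\mathrm K(u,v)b)$ for all $u,v,a,b\in V$. The Ricci form is $\mathrm{ric}_{\mathrm K}(u,v)=\mathrm{tr}\big(a\mapsto \mathrm K(u,a)v\big)$, and the Ricci operator $\mathrm{Ric}_{\mathrm K}$ is the symmetric endomorphism of $V$ with $\langle \mathrm{Ric}_{\mathrm K}(u),v\rangle=\mathrm{ric}_{\mathrm K}(u,v)$. *)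

theory Defs
  imports "HOL-Analysis.Analysis"
begin

definition metric_of_signature ::
    "nat \<Rightarrow> nat \<Rightarrow> ('a::real_vector \<Rightarrow> 'a \<Rightarrow> real) \<Rightarrow> bool"
  where "metric_of_signature p q g \<longleftrightarrow>
    bilinear g \<and> (\<forall>u v. g u v = g v u) \<and>
    (\<exists>e :: nat \<Rightarrow> 'a. inj_on e {..<p + q} \<and> independent (e ` {..<p + q}) \<and>
       span (e ` {..<p + q}) = UNIV \<and>
       (\<forall>i<p + q. \<forall>j<p + q. g (e i) (e j) = (if i \<noteq> j then 0 else if i < p then - 1 else 1)))"

definition positive_definite_on :: "('a::real_vector \<Rightarrow> 'a \<Rightarrow> real) \<Rightarrow> 'a set \<Rightarrow> bool"
  where "positive_definite_on g W \<longleftrightarrow> (\<forall>v\<in>W. v \<noteq> 0 \<longrightarrow> g v v > 0)"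

(* The trace of a linear endomorphism of a finite-dimensional space. The basis
   extend_basis {} is an arbitrary fixed one; the value does not depend on it. *)
definition endo_trace :: "('a::real_vector \<Rightarrow> 'a) \<Rightarrow> real"
  where "endo_trace f =
    (\<Sum>b\<in>extend_basis {}. representation (extend_basis {}) (f b) b)"

definition wedge :: "('a::real_vector \<Rightarrow> 'a \<Rightarrow> real) \<Rightarrow> 'a \<Rightarrow> 'a \<Rightarrow> 'a \<Rightarrow> 'a"
  where "wedge g u v = (\<lambda>w. g v w *\<^sub>R u - g u w *\<^sub>R v)"

(* The space of all finite sums of u wedge v with u, v in W; these are endomorphisms of
   the whole ambient space V, also when W is a proper subspace. If W is nondegenerate, they
   are determined by their restriction to W, so that this is a copy of so(W). *)
definition wedge_space :: "('a::real_vector \<Rightarrow> 'a \<Rightarrow> real) \<Rightarrow> 'a set \<Rightarrow> ('a \<Rightarrow> 'a) set"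
  where "wedge_space g W =
    {A. \<exists>(m::nat) u v. (\<forall>i<m. u i \<in> W \<and> v i \<in> W) \<and>
          A = (\<lambda>x. \<Sum>i<m. wedge g (u i) (v i) x)}"

(* The bilinear form whose values on decomposable elements are
   g v w * g u t - g u w * g v t; see wedge_product_wedge. *)
definition wedge_product :: "('a::real_vector \<Rightarrow> 'a) \<Rightarrow> ('a \<Rightarrow> 'a) \<Rightarrow> real"
  where "wedge_product A B = endo_trace (A \<circ> B) / 2"

(* A curvature tensor on the subspace W of V. Only the values of K on wedge_space g W
   matter; K (wedge g u v) is what is usually written K(u,v). *)
definition curvature_tensor_on ::
    "('a::real_vector \<Rightarrow> 'a \<Rightarrow> real) \<Rightarrow> 'a set \<Rightarrow> (('a \<Rightarrow> 'a) \<Rightarrow> ('a \<Rightarrow> 'a)) \<Rightarrow> bool"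
  where "curvature_tensor_on g W K \<longleftrightarrow>
    (\<forall>A\<in>wedge_space g W. K A \<in> wedge_space g W) \<and>
    (\<forall>A\<in>wedge_space g W. \<forall>B\<in>wedge_space g W.
       K (\<lambda>x. A x + B x) = (\<lambda>x. K A x + K B x)) \<and>
    (\<forall>c. \<forall>A\<in>wedge_space g W. K (\<lambda>x. c *\<^sub>R A x) = (\<lambda>x. c *\<^sub>R K A x)) \<and>
    (\<forall>A\<in>wedge_space g W. \<forall>B\<in>wedge_space g W.
       wedge_product (K A) B = wedge_product A (K B)) \<and>
    (\<forall>u\<in>W. \<forall>v\<in>W. \<forall>w\<in>W.
       K (wedge g u v) w + K (wedge g v w) u + K (wedge g w u) v = 0)"

definition commutator :: "('a::real_vector \<Rightarrow> 'a) \<Rightarrow> ('a \<Rightarrow> 'a) \<Rightarrow> 'a \<Rightarrow> 'a"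
  where "commutator A B = (\<lambda>x. A (B x) - B (A x))"

definition semi_symmetric_on ::
    "('a::real_vector \<Rightarrow> 'a \<Rightarrow> real) \<Rightarrow> 'a set \<Rightarrow> (('a \<Rightarrow> 'a) \<Rightarrow> ('a \<Rightarrow> 'a)) \<Rightarrow> bool"
  where "semi_symmetric_on g W K \<longleftrightarrow>
    curvature_tensor_on g W K \<and>
    (\<forall>u\<in>W. \<forall>v\<in>W. \<forall>a\<in>W. \<forall>b\<in>W.
       commutator (K (wedge g u v)) (K (wedge g a b)) =
       (\<lambda>x. K (wedge g (K (wedge g u v) a) b) x + K (wedge g a (K (wedge g u v) b)) x))"

definition ric ::
    "('a::real_vector \<Rightarrow> 'a \<Rightarrow> real) \<Rightarrow> (('a \<Rightarrow> 'a) \<Rightarrow> ('a \<Rightarrow> 'a)) \<Rightarrow> 'a \<Rightarrow> 'a \<Rightarrow> real"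
  where "ric g K u v = endo_trace (\<lambda>a. K (wedge g u a) v)"

definition Ric ::
    "('a::real_vector \<Rightarrow> 'a \<Rightarrow> real) \<Rightarrow> (('a \<Rightarrow> 'a) \<Rightarrow> ('a \<Rightarrow> 'a)) \<Rightarrow> 'a \<Rightarrow> 'a"
  where "Ric g K u = (THE w. \<forall>v. g w v = ric g K u v)"

(* The complexification of V is V \<times> V, the pair (x, y) standing for x + i y. *)
definition cscale :: "complex \<Rightarrow> 'a::real_vector \<times> 'a \<Rightarrow> 'a \<times> 'a"
  where "cscale z p =
    (Re z *\<^sub>R fst p - Im z *\<^sub>R snd p, Im z *\<^sub>R fst p + Re z *\<^sub>R snd p)"

definition eigenvalues :: "('a::real_vector \<Rightarrow> 'a) \<Rightarrow> complex set"
  where "eigenvalues T = {z. \<exists>p. p \<noteq> 0 \<and> map_prod T T p = cscale z p}"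

definition nonreal_eigenvalues :: "('a::real_vector \<Rightarrow> 'a) \<Rightarrow> complex set"
  where "nonreal_eigenvalues T = {z \<in> eigenvalues T. z \<notin> \<real>}"

definition nonzero_real_eigenvalues :: "('a::real_vector \<Rightarrow> 'a) \<Rightarrow> real set"
  where "nonzero_real_eigenvalues T = {a. a \<noteq> 0 \<and> complex_of_real a \<in> eigenvalues T}"

definition eigenspace :: "('a::real_vector \<Rightarrow> 'a) \<Rightarrow> real \<Rightarrow> 'a set"
  where "eigenspace T a = {v. T v = a *\<^sub>R v}"

definition splits_orthogonally ::
    "('a::real_vector \<Rightarrow> 'a \<Rightarrow> real) \<Rightarrow> 'a set list \<Rightarrow> bool"
  where "splits_orthogonally g Ws \<longleftrightarrow>
    (\<forall>W\<in>set Ws. subspace W) \<and>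
    (\<forall>i<length Ws. \<forall>j<length Ws. i \<noteq> j \<longrightarrow>
       (\<forall>x\<in>Ws ! i. \<forall>y\<in>Ws ! j. g x y = 0)) \<and>
    (\<forall>v. \<exists>!xs. list_all2 (\<in>) xs Ws \<and> sum_list xs = v)"

lemma endo_trace_rank_one:
  fixes e :: "nat \<Rightarrow> 'a::real_vector" and u :: 'a
  assumes fin: "span (e ` {..<n}) = UNIV" and l: "linear l"
  shows "endo_trace (\<lambda>x. l x *\<^sub>R u) = l u"
proof -
  define B :: "'a set" where "B = extend_basis {}"
  have iB: "independent B" and sB: "span B = UNIV"
    unfolding B_def
    using independent_extend_basis[of "{}"] span_extend_basis[of "{}"] independent_empty by blast+
  have "finite B"
    using independent_span_bound[of "e ` {..<n}" B] fin iB by simp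
  have "endo_trace (\<lambda>x. l x *\<^sub>R u) = (\<Sum>b\<in>B. l b * representation B u b)"
    unfolding endo_trace_def B_def[symmetric]
    using iB sB by (simp add: representation_scale)
  also have "\<dots> = l (\<Sum>b\<in>B. representation B u b *\<^sub>R b)"
    using l by (simp add: linear_sum linear_scale mult.commute)
  also have "\<dots> = l u"
    using sum_representation_eq[OF iB _ \<open>finite B\<close>, of u] sB by simp
  finally show ?thesis .
qed

lemma endo_trace_diff:
  fixes f h :: "'a::real_vector \<Rightarrow> 'a"
  shows "endo_trace (\<lambda>x. f x - h x) = endo_trace f - endo_trace h"
proof -
  have "independent (extend_basis ({}::'a set))" "span (extend_basis ({}::'a set)) = UNIV"
    using independent_extend_basis[of "{}"] span_extend_basis[of "{}"] independent_empty by blast+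
  then show ?thesis
    unfolding endo_trace_def by (simp add: representation_diff sum_subtractf)
qed

lemma wedge_product_wedge:
  assumes "metric_of_signature p q g"
  shows "wedge_product (wedge g u v) (wedge g w t) = g v w * g u t - g u w * g v t"
proof -
  obtain e :: "nat \<Rightarrow> 'a" where e: "span (e ` {..<p + q}) = UNIV"
    using assms unfolding metric_of_signature_def by blast
  have bil: "bilinear g" and sym: "\<And>x y. g x y = g y x"
    using assms unfolding metric_of_signature_def by blast+
  have lin: "linear (\<lambda>x. c * g x1 x - d * g x2 x)" for c d x1 x2
    by (rule linearI) (simp_all add: bilinear_radd[OF bil] bilinear_rmul[OF bil] algebra_simps)
  have "wedge g u v \<circ> wedge g w t =
      (\<lambda>x. (g v w * g t x - g v t * g w x) *\<^sub>R u - (g u w * g t x - g u t * g w x) *\<^sub>R v)"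
    by (simp add: wedge_def fun_eq_iff bilinear_rsub[OF bil] bilinear_rmul[OF bil] mult.commute)
  then have "endo_trace (wedge g u v \<circ> wedge g w t) =
      (g v w * g t u - g v t * g w u) - (g u w * g t v - g u t * g w v)"
    by (simp only: endo_trace_diff endo_trace_rank_one[OF e lin])
  then show ?thesis
    unfolding wedge_product_def
    by (simp add: sym[of t u] sym[of w u] sym[of t v] sym[of w v] mult.commute)
qed

(* In finite dimension the non-zero real eigenvalues can thus be listed. *)
lemma finite_nonzero_real_eigenvalues:
  assumes "metric_of_signature p q (g :: 'a::real_vector \<Rightarrow> 'a \<Rightarrow> real)"
    and lin: "linear (T :: 'a \<Rightarrow> 'a)"
  shows "finite (nonzero_real_eigenvalues T)"
proof -
  obtain e :: "nat \<Rightarrow> 'a" where e: "span (e ` {..<p + q}) = UNIV"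
    using assms unfolding metric_of_signature_def by blast
  define X where "X = nonzero_real_eigenvalues T"
  have "\<exists>v. v \<noteq> 0 \<and> T v = a *\<^sub>R v" if a: "a \<in> X" for a
  proof -
    obtain x y where "(x, y) \<noteq> 0" "map_prod T T (x, y) = cscale (complex_of_real a) (x, y)"
      using a unfolding X_def nonzero_real_eigenvalues_def eigenvalues_def by auto
    then show ?thesis
      by (auto simp: cscale_def zero_prod_def)
  qed
  then obtain f where f: "\<And>a. a \<in> X \<Longrightarrow> f a \<noteq> 0 \<and> T (f a) = a *\<^sub>R f a"
    by metis
  have key: "(\<forall>a\<in>S. c a = 0)"
    if "finite S" "S \<subseteq> X" "(\<Sum>a\<in>S. c a *\<^sub>R f a) = 0" for S c
    using that
  proof (induction S arbitrary: c rule: finite_induct)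
    case (insert s S)
    have s0: "c s *\<^sub>R f s + (\<Sum>a\<in>S. c a *\<^sub>R f a) = 0"
      using insert by simp
    have "0 = T (c s *\<^sub>R f s + (\<Sum>a\<in>S. c a *\<^sub>R f a))"
      using s0 lin by (simp add: linear_0)
    also have "\<dots> = s *\<^sub>R (c s *\<^sub>R f s) + (\<Sum>a\<in>S. (c a * a) *\<^sub>R f a)"
    proof -
      have "(\<Sum>a\<in>S. c a *\<^sub>R T (f a)) = (\<Sum>a\<in>S. (c a * a) *\<^sub>R f a)"
        by (rule sum.cong) (use insert.prems f in auto)
      moreover have "T (f s) = s *\<^sub>R f s" using insert.prems f by auto
      ultimately show ?thesis
        using lin by (simp add: linear_add linear_scale linear_sum)
    qed
    finally have *: "s *\<^sub>R (c s *\<^sub>R f s) + (\<Sum>a\<in>S. (c a * a) *\<^sub>R f a) = 0" by simp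
    have "c s *\<^sub>R f s = - (\<Sum>a\<in>S. c a *\<^sub>R f a)"
      using s0 by (simp add: eq_neg_iff_add_eq_0)
    with * have "(\<Sum>a\<in>S. (c a * a) *\<^sub>R f a) - (\<Sum>a\<in>S. (s * c a) *\<^sub>R f a) = 0"
      by (simp add: scaleR_sum_right)
    then have "(\<Sum>a\<in>S. (c a * (a - s)) *\<^sub>R f a) = 0"
      by (simp add: sum_subtractf[symmetric] algebra_simps)
    then have "\<forall>a\<in>S. c a * (a - s) = 0"
      using insert.IH[of "\<lambda>a. c a * (a - s)"] insert.prems(1) by simp
    then have S0: "\<forall>a\<in>S. c a = 0"
      using insert.hyps by auto
    then have "c s *\<^sub>R f s = 0"
      using s0 by simp
    then show ?case
      using S0 f insert.prems by auto
  qed simp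
  have inj: "inj_on f X"
  proof (rule inj_onI, rule ccontr)
    fix a b assume ab: "a \<in> X" "b \<in> X" "f a = f b" "a \<noteq> b"
    then have "a *\<^sub>R f a = b *\<^sub>R f a" using f by metis
    then show False using ab f by auto
  qed
  have bound: "card S \<le> card (e ` {..<p + q})" if S: "finite S" "S \<subseteq> X" for S
  proof -
    have "independent (f ` S)"
    proof (rule independent_if_scalars_zero)
      show "finite (f ` S)" using S by simp
      fix d x assume d: "(\<Sum>x\<in>f ` S. d x *\<^sub>R x) = 0" and x: "x \<in> f ` S"
      have "(\<Sum>a\<in>S. d (f a) *\<^sub>R f a) = 0"
        using d by (simp add: sum.reindex[OF inj_on_subset[OF inj S(2)]])
      then show "d x = 0" using key[OF S, of "\<lambda>a. d (f a)"] x by auto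
    qed
    then have "card (f ` S) \<le> card (e ` {..<p + q})"
      using independent_span_bound[of "e ` {..<p + q}" "f ` S"] e by simp
    then show ?thesis
      using card_image[OF inj_on_subset[OF inj S(2)]] by simp
  qed
  show ?thesis
  proof (rule ccontr)
    assume "infinite (nonzero_real_eigenvalues T)"
    then obtain S where "finite S" "S \<subseteq> X" "card S = Suc (card (e ` {..<p + q}))"
      using infinite_arbitrarily_large unfolding X_def by blast
    with bound[of S] show False by simp
  qed
qed

end

theory Submission
  imports Defs
    "HOL-Computational_Algebra.Polynomial_Factorial"
    "HOL-Computational_Algebra.Field_as_Ring"
    "HOL-Computational_Algebra.Fundamental_Theorem_Algebra"
begin

text \<open>
Write \<open>R u v\<close> for \<open>K (u \<and> v)\<close> and \<open>T\<close> for the Ricci operator. Since \<open>R u v\<close> acts as a derivation of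
the whole curvature tensor, \<open>T\<close> commutes with every \<open>R u v\<close>; by the pair symmetry of the curvature
\<open>T\<close> is self-adjoint.

The key is that the curvature is multilinear over its commutant: if a self-adjoint \<open>P\<close> commutes with
all \<open>R u v\<close>, then \<open>R (P u) v = P \<circ> R u v\<close> (lemma \<open>R_intertwiner\<close>). Hence \<open>g (T (P u)) v\<close> is the trace of
\<open>P \<circ> M\<close>, where \<open>M a = R u a v\<close> commutes with \<open>P\<close>. If \<open>P\<close> is nilpotent, so is \<open>P \<circ> M\<close>, and therefore
\<open>T \<circ> P = 0\<close> (lemma \<open>T_nilpotent_intertwiner\<close>). Polynomials in \<open>T\<close> are such endomorphisms \<open>P\<close>, and this
makes all repeated factors of an annihilating polynomial of \<open>T\<close> cancel, except for a square of the
indeterminate: in every signature, \<open>T\<close> is annihilated by \<open>X\<^sup>2\<close> times the product of the distinct real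
minimal polynomials of its non-zero eigenvalues (lemma \<open>annihilated_by_eigenvalues\<close>). These factors are
pairwise coprime, and coprime polynomials in a self-adjoint endomorphism have orthogonal kernels, so
\<open>V\<close> splits orthogonally into the kernels.

The signature matters only if there is a non-real eigenvalue \<open>z\<close>. On the kernel \<open>V\<^sub>c\<close> of its minimal
polynomial, \<open>J = (T - Re z) / Im z\<close> is a self-adjoint complex structure, so that \<open>g\<close> is the real
part of a nondegenerate complex symmetric form, and each non-null vector for that form has a complex multiple \<open>v\<close> with
\<open>g v v = -1\<close> and \<open>g v (J v) = 0\<close>. If \<open>V\<^sub>c\<close> were a complex line, then \<open>R v\<close> would vanish, because the curvature
is complex bilinear and skew on that line and mixed terms are zero; but then \<open>T v = 0\<close>, which is absurd.
So \<open>V\<^sub>c\<close> contains two orthogonal vectors of square \<open>-1\<close>, and these use up the index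
(lemma \<open>nonreal_eigenvalue_kernel\<close>). Everything follows: there is no room for a third such vector, so
\<open>V\<^sub>c\<close> has complex dimension two; all other summands, being orthogonal to \<open>V\<^sub>c\<close>, are positive
definite; no second pair of non-real eigenvalues fits; and a self-adjoint nilpotent endomorphism of a
positive definite space is zero, so \<open>ker T\<^sup>2 = ker T\<close>. Finally the projection onto each summand is a
polynomial in \<open>T\<close>, hence commutes with the curvature, which therefore restricts to the summand.
\<close>

section \<open>Real polynomials and their complex roots\<close>

abbreviation cpoly :: "real poly \<Rightarrow> complex \<Rightarrow> complex"
  where "cpoly p \<equiv> poly (map_poly complex_of_real p)"

definition min_real_poly :: "complex \<Rightarrow> real poly"
  where "min_real_poly z = (if z \<in> \<real> then [:- Re z, 1:] else [:(cmod z)\<^sup>2, - 2 * Re z, 1:])"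

lemma cpoly_add: "cpoly (p + q) z = cpoly p z + cpoly q z"
  by (induction p q rule: poly_induct2) (auto simp: map_poly_pCons algebra_simps)

lemma cpoly_smult: "cpoly (smult a p) z = of_real a * cpoly p z"
  by (induction p) (auto simp: map_poly_pCons algebra_simps)

lemma cpoly_mult: "cpoly (p * q) z = cpoly p z * cpoly q z"
  by (induction p) (auto simp: map_poly_pCons cpoly_add cpoly_smult algebra_simps)

lemma cpoly_dvd: "p dvd q \<Longrightarrow> cpoly p z = 0 \<Longrightarrow> cpoly q z = 0"
  by (auto simp: dvd_def cpoly_mult)

lemma cpoly_cnj: "cpoly p (cnj z) = cnj (cpoly p z)"
  by (induction p) (auto simp: map_poly_pCons)

lemma cpoly_min_real_poly: "cpoly (min_real_poly z) w = 0 \<longleftrightarrow> w = z \<or> w = cnj z"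
proof (cases "z \<in> \<real>")
  case True
  then show ?thesis
    by (auto simp: min_real_poly_def map_poly_pCons complex_is_Real_iff complex_eq_iff)
next
  case False
  have "cpoly (min_real_poly z) w = (w - z) * (w - cnj z)"
    using False unfolding min_real_poly_def cmod_power2
    by (auto simp: map_poly_pCons complex_eq_iff algebra_simps power2_eq_square)
  then show ?thesis by simp
qed

text \<open>The remainder modulo the minimal polynomial is too small in degree to vanish at \<open>z\<close> unless it is zero.\<close>

lemma min_real_poly_dvd:
  assumes "cpoly p z = 0"
  shows "min_real_poly z dvd p"
proof -
  let ?l = "min_real_poly z"
  let ?r = "p mod ?l"
  have "cpoly p z = cpoly (p div ?l) z * cpoly ?l z + cpoly ?r z"
    by (simp flip: cpoly_mult cpoly_add)
  then have r0: "cpoly ?r z = 0"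
    using assms cpoly_min_real_poly[of z z] by simp
  have nz: "?l \<noteq> 0" by (simp add: min_real_poly_def)
  have "?r = 0"
  proof (cases "z \<in> \<real>")
    case True
    then have "degree ?l = 1" by (simp add: min_real_poly_def)
    then have "degree ?r = 0"
      using degree_mod_less[OF nz, of p] by auto
    then obtain a where "?r = [:a:]" by (meson degree_eq_zeroE)
    with r0 show ?thesis by (simp add: map_poly_pCons)
  next
    case False
    then have "degree ?l = 2" by (simp add: min_real_poly_def)
    then have "degree ?r \<le> 1"
      using degree_mod_less[OF nz, of p] by auto
    then have r: "?r = [:coeff ?r 0, coeff ?r 1:]"
      by (intro poly_eqI) (auto simp: coeff_pCons coeff_eq_0 split: nat.splits)
    have "of_real (coeff ?r 0) + z * of_real (coeff ?r 1) = 0"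
      using r0 by (subst (asm) r) (simp add: map_poly_pCons)
    then have "coeff ?r 1 = 0" "coeff ?r 0 = 0"
      using False by (auto simp: complex_eq_iff complex_is_Real_iff)
    then show ?thesis using r by simp
  qed
  then show ?thesis by auto
qed

lemma real_poly_factor:
  fixes p :: "real poly"
  assumes "degree p \<noteq> 0"
  obtains z where "min_real_poly z dvd p"
proof -
  have "degree (map_poly complex_of_real p) \<noteq> 0"
    using assms by (simp add: degree_map_poly)
  then have "\<not> constant (poly (map_poly complex_of_real p))"
    by (simp add: constant_degree)
  then obtain z where "cpoly p z = 0"
    using fundamental_theorem_of_algebra by blast
  then show ?thesis using min_real_poly_dvd that by blast
qed

text \<open>A common factor of positive degree would have a complex root, by the fundamental theorem of algebra.\<close>

lemma coprime_if_no_common_root: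
  fixes p q :: "real poly"
  assumes "\<And>z. cpoly p z = 0 \<Longrightarrow> cpoly q z \<noteq> 0"
  shows "coprime p q"
proof (rule coprimeI)
  fix d assume d: "d dvd p" "d dvd q"
  have "d \<noteq> 0" using d assms[of 0] by auto
  moreover have "degree d = 0"
  proof (rule ccontr)
    assume "degree d \<noteq> 0"
    then obtain z where "min_real_poly z dvd d" by (rule real_poly_factor)
    then have "cpoly d z = 0" by (rule cpoly_dvd) (simp add: cpoly_min_real_poly)
    then show False using d assms cpoly_dvd by blast
  qed
  ultimately show "is_unit d" by (simp add: is_unit_iff_degree)
qed

lemma min_real_poly_cnj: "min_real_poly (cnj z) = min_real_poly z"
  by (simp add: min_real_poly_def Reals_cnj_iff complex_is_Real_iff)

lemma degree_min_real_poly: "degree (min_real_poly z) \<noteq> 0"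
  by (simp add: min_real_poly_def)

lemma min_real_poly_0: "min_real_poly 0 = [:0, 1:]"
  by (simp add: min_real_poly_def)

lemma coprime_min_real_poly:
  "z \<noteq> w \<Longrightarrow> z \<noteq> cnj w \<Longrightarrow> coprime (min_real_poly z) (min_real_poly w)"
  by (rule coprime_if_no_common_root) (auto simp: cpoly_min_real_poly)

section \<open>Polynomials in an endomorphism\<close>

definition poly_endo :: "('a::real_vector \<Rightarrow> 'a) \<Rightarrow> real poly \<Rightarrow> 'a \<Rightarrow> 'a"
  where "poly_endo T p v = (\<Sum>i\<le>degree p. coeff p i *\<^sub>R (T ^^ i) v)"

lemma poly_endo_0 [simp]: "poly_endo T 0 v = 0"
  by (simp add: poly_endo_def)

lemma poly_endo_pCons:
  assumes "linear T"
  shows "poly_endo T (pCons a p) v = a *\<^sub>R v + T (poly_endo T p v)"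
proof (cases "p = 0")
  case True
  then show ?thesis using linear_0[OF assms] by (simp add: poly_endo_def)
next
  case False
  then show ?thesis
    by (simp add: poly_endo_def sum.atMost_Suc_shift linear_sum[OF assms] linear_scale[OF assms]
        del: sum.atMost_Suc)
qed

lemma poly_endo_1 [simp]: "poly_endo T 1 v = v"
  by (simp add: poly_endo_def)

lemma linear_poly_endo: "linear T \<Longrightarrow> linear (poly_endo T p)"
  by (induction p) (auto simp: linear_iff poly_endo_pCons algebra_simps)

lemma poly_endo_add:
  "linear T \<Longrightarrow> poly_endo T (p + q) v = poly_endo T p v + poly_endo T q v"
  by (induction p q rule: poly_induct2) (auto simp: poly_endo_pCons linear_add algebra_simps)

lemma poly_endo_smult: "linear T \<Longrightarrow> poly_endo T (smult a p) v = a *\<^sub>R poly_endo T p v"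
  by (induction p) (auto simp: poly_endo_pCons linear_add linear_scale algebra_simps)

lemma poly_endo_mult:
  "linear T \<Longrightarrow> poly_endo T (p * q) v = poly_endo T p (poly_endo T q v)"
  by (induction p) (auto simp: poly_endo_pCons poly_endo_add poly_endo_smult)

lemma poly_endo_commute: "linear T \<Longrightarrow> poly_endo T p (T v) = T (poly_endo T p v)"
  by (induction p) (auto simp: poly_endo_pCons linear_0 linear_add linear_scale)

lemma poly_endo_mult_eq_0:
  assumes "linear T" "poly_endo T q v = 0"
  shows "poly_endo T (p * q) v = 0"
  using assms by (simp add: poly_endo_mult linear_0[OF linear_poly_endo])

lemma poly_endo_dvd:
  "linear T \<Longrightarrow> p dvd q \<Longrightarrow> poly_endo T p v = 0 \<Longrightarrow> poly_endo T q v = 0"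
  by (metis dvd_def mult.commute poly_endo_mult_eq_0)

lemma poly_endo_min_real_poly:
  assumes "linear T"
  shows "poly_endo T (min_real_poly z) v =
    (if z \<in> \<real> then T v - Re z *\<^sub>R v else T (T v) - (2 * Re z) *\<^sub>R T v + (cmod z)\<^sup>2 *\<^sub>R v)"
  using assms
  by (simp add: min_real_poly_def poly_endo_pCons linear_0 linear_add linear_scale linear_diff linear_neg algebra_simps)

lemma poly_endo_X2: "linear T \<Longrightarrow> poly_endo T [:0, 0, 1:] v = T (T v)"
  by (simp add: poly_endo_pCons linear_0)

text \<open>For a non-real \<open>z\<close>, the real and the imaginary part of a complex eigenvector are both killed by the
minimal polynomial of \<open>z\<close>. Conversely a real vector \<open>x\<close> in that kernel is the real part of an eigenvector,
whose imaginary part \<open>y\<close> is forced by \<open>T x = Re z x - Im z y\<close>. Eigenvalues thus become a matter of real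
kernels.\<close>

lemma eigenvalues_iff:
  assumes T: "linear T"
  shows "z \<in> eigenvalues T \<longleftrightarrow> (\<exists>x. x \<noteq> 0 \<and> poly_endo T (min_real_poly z) x = 0)"
proof -
  have ev: "z \<in> eigenvalues T \<longleftrightarrow> (\<exists>x y. (x \<noteq> 0 \<or> y \<noteq> 0) \<and>
      T x = Re z *\<^sub>R x - Im z *\<^sub>R y \<and> T y = Im z *\<^sub>R x + Re z *\<^sub>R y)"
    by (auto simp: eigenvalues_def cscale_def zero_prod_def)
  show ?thesis
  proof (cases "z \<in> \<real>")
    case True
    then have "Im z = 0" by (simp add: complex_is_Real_iff)
    then show ?thesis
      using True linear_0[OF T] unfolding ev poly_endo_min_real_poly[OF T] by auto
  next
    case False
    then have b: "Im z \<noteq> 0" by (simp add: complex_is_Real_iff)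
    let ?q = "poly_endo T (min_real_poly z)"
    have q: "?q x = T (T x) - (Re z *\<^sub>R T x + Re z *\<^sub>R T x) + ((Re z)\<^sup>2 + (Im z)\<^sup>2) *\<^sub>R x" for x
      using False by (simp add: poly_endo_min_real_poly[OF T] cmod_power2 flip: scaleR_left_distrib)
    show ?thesis
    proof
      assume "z \<in> eigenvalues T"
      then obtain x y where xy: "x \<noteq> 0 \<or> y \<noteq> 0"
          "T x = Re z *\<^sub>R x - Im z *\<^sub>R y" "T y = Im z *\<^sub>R x + Re z *\<^sub>R y"
        unfolding ev by blast
      have "?q x = 0"
        unfolding q by (simp add: xy linear_diff[OF T] linear_scale[OF T] algebra_simps power2_eq_square)
      moreover have "?q y = 0"
        unfolding q by (simp add: xy linear_add[OF T] linear_scale[OF T] algebra_simps power2_eq_square)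
      ultimately show "\<exists>x. x \<noteq> 0 \<and> ?q x = 0" using xy(1) by blast
    next
      assume "\<exists>x. x \<noteq> 0 \<and> ?q x = 0"
      then obtain x where x: "x \<noteq> 0" "?q x = 0" by blast
      then have TT: "T (T x) = Re z *\<^sub>R T x + Re z *\<^sub>R T x - ((Re z)\<^sup>2 + (Im z)\<^sup>2) *\<^sub>R x"
        unfolding q by (simp add: algebra_simps)
      define y where "y = (1 / Im z) *\<^sub>R (Re z *\<^sub>R x - T x)"
      have y: "Im z *\<^sub>R y = Re z *\<^sub>R x - T x" using b by (simp add: y_def)
      have "Im z *\<^sub>R T y = Im z *\<^sub>R (Im z *\<^sub>R x) + Re z *\<^sub>R (Im z *\<^sub>R y)"
        unfolding linear_scale[OF T, symmetric] y
        by (simp add: linear_diff[OF T] linear_scale[OF T] TT algebra_simps power2_eq_square)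
      then have "Im z *\<^sub>R T y = Im z *\<^sub>R (Im z *\<^sub>R x + Re z *\<^sub>R y)"
        by (simp add: algebra_simps)
      then have "T y = Im z *\<^sub>R x + Re z *\<^sub>R y"
        using b by simp
      moreover have "T x = Re z *\<^sub>R x - Im z *\<^sub>R y" using y by simp
      ultimately show "z \<in> eigenvalues T" unfolding ev using x(1) by blast
    qed
  qed
qed

text \<open>The Bezout identity, evaluated at \<open>T\<close>. If \<open>T\<close> is annihilated by \<open>p * q\<close>, the two terms are the
projections to the kernels of \<open>q\<close> and of \<open>p\<close>.\<close>

lemma coprime_kernel_split:
  assumes T: "linear T" and pq: "coprime p q"
  obtains a b where "\<And>v. v = poly_endo T (a * p) v + poly_endo T (b * q) v"
proof -
  obtain a b where "a * p + b * q = 1"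
    using bezout_coefficients_fst_snd[of p q] pq by (metis coprime_iff_gcd_eq_1)
  then have "v = poly_endo T (a * p) v + poly_endo T (b * q) v" for v
    by (simp flip: poly_endo_add[OF T])
  then show ?thesis using that by blast
qed

text \<open>Otherwise the minimal polynomial of \<open>z\<close> is coprime to \<open>m\<close>, so that it acts injectively.\<close>

lemma eigenvalue_is_root:
  assumes T: "linear T" and m: "\<And>v. poly_endo T m v = 0" and z: "z \<in> eigenvalues T"
  shows "cpoly m z = 0"
proof (rule ccontr)
  assume nz: "cpoly m z \<noteq> 0"
  obtain x where x: "x \<noteq> 0" "poly_endo T (min_real_poly z) x = 0"
    using z eigenvalues_iff[OF T] by blast
  have "coprime (min_real_poly z) m"
    by (rule coprime_if_no_common_root) (use nz in \<open>auto simp: cpoly_min_real_poly cpoly_cnj\<close>)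
  then obtain a b where "\<And>v. v = poly_endo T (a * min_real_poly z) v + poly_endo T (b * m) v"
    using coprime_kernel_split[OF T] by blast
  from this[of x] x m show False
    by (simp add: poly_endo_mult[OF T] linear_0[OF linear_poly_endo[OF T]])
qed

text \<open>Induction on the list: the Bezout identity for the first factor and the product of the others splits
off one summand.\<close>

lemma kernel_sum_of_coprime_factors:
  assumes T: "linear T"
  shows "sorted_wrt coprime ps \<Longrightarrow> poly_endo T (prod_list ps) v = 0 \<Longrightarrow>
    \<exists>xs. list_all2 (\<lambda>x p. poly_endo T p x = 0) xs ps \<and> sum_list xs = v"
proof (induction ps arbitrary: v)
  case (Cons p ps)
  have "coprime p (prod_list ps)"
    using Cons.prems(1) by (auto intro: prod_list_coprime_right)
  then obtain a b where ab: "\<And>v. v = poly_endo T (a * p) v + poly_endo T (b * prod_list ps) v"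
    using coprime_kernel_split[OF T] by blast
  have "poly_endo T (prod_list ps) (poly_endo T (a * p) v) = poly_endo T (a * prod_list (p # ps)) v"
    by (simp flip: poly_endo_mult[OF T] add: ac_simps)
  also have "\<dots> = 0" by (rule poly_endo_mult_eq_0[OF T Cons.prems(2)])
  finally obtain xs where xs: "list_all2 (\<lambda>x p. poly_endo T p x = 0) xs ps"
      "sum_list xs = poly_endo T (a * p) v"
    using Cons by (metis sorted_wrt.simps(2))
  have "poly_endo T p (poly_endo T (b * prod_list ps) v) = poly_endo T (b * prod_list (p # ps)) v"
    by (simp flip: poly_endo_mult[OF T] add: ac_simps)
  also have "\<dots> = 0" by (rule poly_endo_mult_eq_0[OF T Cons.prems(2)])
  finally have "list_all2 (\<lambda>x p. poly_endo T p x = 0)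
      (poly_endo T (b * prod_list ps) v # xs) (p # ps)" using xs by simp
  moreover have "sum_list (poly_endo T (b * prod_list ps) v # xs) = v"
    using xs ab[of v] by (simp add: add.commute)
  ultimately show ?case by blast
qed simp

lemma kernel_min_real_poly_of_real:
  assumes "linear T"
  shows "{v. poly_endo T (min_real_poly (of_real a)) v = 0} = eigenspace T a"
  using assms by (simp add: poly_endo_min_real_poly eigenspace_def)

lemma cnj_eigenvalue: "linear T \<Longrightarrow> z \<in> eigenvalues T \<Longrightarrow> cnj z \<in> eigenvalues T"
  by (simp add: eigenvalues_iff min_real_poly_cnj)

section \<open>Traces in an orthonormal basis\<close>

text \<open>A scalar product together with an orthonormal basis, whose signs \<open>\<epsilon>\<close> are arbitrary; only the results
on non-real eigenvalues fix the index.\<close>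

locale pseudo_orthonormal =
  fixes g :: "'a::real_vector \<Rightarrow> 'a \<Rightarrow> real" and e :: "nat \<Rightarrow> 'a" and N :: nat and \<epsilon> :: "nat \<Rightarrow> real"
  assumes bilinear: "bilinear g" and sym: "g u v = g v u"
    and span_e: "span (e ` {..<N}) = UNIV"
    and orthonormal: "i < N \<Longrightarrow> j < N \<Longrightarrow> g (e i) (e j) = (if i = j then \<epsilon> i else 0)"
    and sign: "i < N \<Longrightarrow> \<epsilon> i * \<epsilon> i = 1"
begin

lemmas g_simps =
  bilinear_ladd[OF bilinear] bilinear_radd[OF bilinear]
  bilinear_lmul[OF bilinear] bilinear_rmul[OF bilinear]
  bilinear_lneg[OF bilinear] bilinear_rneg[OF bilinear]
  bilinear_lsub[OF bilinear] bilinear_rsub[OF bilinear]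
  bilinear_lzero[OF bilinear] bilinear_rzero[OF bilinear]

lemma linear_g: "linear (g u)"
  by (rule linearI) (simp_all add: g_simps)

lemma g_sum_left: "g (\<Sum>i\<in>I. f i) v = (\<Sum>i\<in>I. g (f i) v)"
  using linear_sum[OF linear_g[of v], of f I] by (simp add: sym[of v])

lemma g_sum_right: "g v (\<Sum>i\<in>I. f i) = (\<Sum>i\<in>I. g v (f i))"
  using linear_sum[OF linear_g[of v], of f I] by simp

text \<open>Both sides are linear and agree on the basis.\<close>

lemma expand: "x = (\<Sum>i<N. (\<epsilon> i * g x (e i)) *\<^sub>R e i)"
proof -
  have lin: "linear (\<lambda>x. \<Sum>i<N. (\<epsilon> i * g x (e i)) *\<^sub>R e i)"
    by (rule linearI) (simp_all add: g_simps algebra_simps sum.distrib scaleR_sum_right)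
  have "(\<Sum>i<N. (\<epsilon> i * g (e j) (e i)) *\<^sub>R e i) = e j" if "j < N" for j
  proof -
    have "(\<Sum>i<N. (\<epsilon> i * g (e j) (e i)) *\<^sub>R e i) = (\<Sum>i<N. if j = i then e i else 0)"
      using that by (intro sum.cong) (auto simp: orthonormal sign)
    then show ?thesis using that by simp
  qed
  then show ?thesis
    by (intro linear_eq_on_span[OF linear_ident lin, of "e ` {..<N}" x]) (auto simp: span_e)
qed

lemma nondegenerate: "(\<And>y. g x y = 0) \<Longrightarrow> x = 0"
  using expand[of x] by simp

lemma eq_if_g_eq: "(\<And>y. g x y = g x' y) \<Longrightarrow> x = x'"
  using nondegenerate[of "x - x'"] by (simp add: g_simps)

lemma trace_rank_one: "linear l \<Longrightarrow> endo_trace (\<lambda>x. l x *\<^sub>R u) = l u" for u :: 'a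
  by (rule endo_trace_rank_one[OF span_e])

lemma trace_sum: "endo_trace (\<lambda>x. \<Sum>i\<in>I. f i x) = (\<Sum>i\<in>I. endo_trace (f i))" for f :: "_ \<Rightarrow> 'a \<Rightarrow> 'a"
proof -
  have "independent (extend_basis ({}::'a set))" "span (extend_basis ({}::'a set)) = UNIV"
    using independent_extend_basis[of "{}"] span_extend_basis[of "{}"] independent_empty by blast+
  then show ?thesis
    unfolding endo_trace_def by (simp add: representation_sum sum.swap[of _ I])
qed

lemma trace_formula:
  assumes "linear f"
  shows "endo_trace f = (\<Sum>i<N. \<epsilon> i * g (f (e i)) (e i))"
proof -
  have "f x = (\<Sum>i<N. (\<epsilon> i * g x (e i)) *\<^sub>R f (e i))" for x
    by (subst expand[of x]) (simp add: linear_sum[OF assms] linear_scale[OF assms])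
  then have "endo_trace f = endo_trace (\<lambda>x. \<Sum>i<N. (\<epsilon> i * g x (e i)) *\<^sub>R f (e i))"
    by (intro arg_cong[of _ _ endo_trace] ext)
  moreover have "linear (\<lambda>x. \<epsilon> i * g x (e i))" for i
    by (rule linearI) (simp_all add: g_simps algebra_simps)
  ultimately show ?thesis
    by (simp add: trace_sum trace_rank_one)
qed

text \<open>Expanding \<open>B x\<close> in the basis makes \<open>A \<circ> B\<close> a sum of endomorphisms of rank one.\<close>

lemma trace_cyclic:
  fixes A B :: "'a \<Rightarrow> 'a"
  assumes A: "linear A" and B: "linear B"
  shows "endo_trace (\<lambda>x. A (B x)) = endo_trace (\<lambda>x. B (A x))"
proof -
  have "A (B x) = (\<Sum>i<N. (\<epsilon> i * g (B x) (e i)) *\<^sub>R A (e i))" for x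
    by (subst expand[of "B x"]) (simp add: linear_sum[OF A] linear_scale[OF A])
  moreover have "linear (\<lambda>x. \<epsilon> i * g (B x) (e i))" for i
    by (rule linearI) (simp_all add: g_simps linear_add[OF B] linear_scale[OF B] algebra_simps)
  ultimately have "endo_trace (\<lambda>x. A (B x)) = (\<Sum>i<N. \<epsilon> i * g (B (A (e i))) (e i))"
    by (simp add: trace_sum trace_rank_one)
  also have "\<dots> = endo_trace (\<lambda>x. B (A x))"
    using trace_formula[OF linear_compose[OF A B]] by (simp add: o_def)
  finally show ?thesis .
qed

lemma trace_adjoint:
  assumes "linear A" "linear B" "\<And>x y. g (A x) y = g x (B y)"
  shows "endo_trace A = endo_trace B"
  using assms by (simp add: trace_formula sym)

lemma ex_projection:
  fixes W :: "'a set"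
  assumes "subspace W"
  obtains P where "linear P" "\<And>x. P x \<in> W" "\<And>x. x \<in> W \<Longrightarrow> P x = x"
proof -
  obtain B where B: "B \<subseteq> W" "independent B" "W = span B"
    using basis_exists[of W] assms by (metis span_subspace)
  obtain P where P: "linear P" "\<And>x. x \<in> B \<Longrightarrow> P x = x" "range P = span B"
    using linear_independent_extend_subspace[OF B(2), of "\<lambda>x. x"] by auto
  have "P x = x" if "x \<in> W" for x
    using linear_eq_on_span[OF P(1) linear_ident, of B x] P(2) that B(3) by auto
  then show ?thesis using that[of P] P B(3) by blast
qed

text \<open>If \<open>P\<close> is a projection onto the range of \<open>A\<close>, then \<open>A = P \<circ> A\<close> has the same trace as \<open>A \<circ> P\<close>. Repeating
this, \<open>P\<close> may be replaced by a projection onto the range of any power of \<open>A\<close>, hence by zero.\<close>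

lemma trace_nilpotent:
  fixes A :: "'a \<Rightarrow> 'a"
  assumes A: "linear A" and nil: "\<And>x. (A ^^ k) x = 0"
  shows "endo_trace A = 0"
proof -
  have lin: "linear (A ^^ j)" for j
    by (induction j) (use A in \<open>auto simp: linear_iff\<close>)
  have "endo_trace A = endo_trace (\<lambda>x. A (P x))"
    if "linear P" "\<And>x. P x \<in> range (A ^^ j)" "\<And>x. x \<in> range (A ^^ j) \<Longrightarrow> P x = x" for j P
    using that
  proof (induction j arbitrary: P)
    case (Suc j)
    obtain Q where Q: "linear Q" "\<And>x. Q x \<in> range (A ^^ j)" "\<And>x. x \<in> range (A ^^ j) \<Longrightarrow> Q x = x"
      using ex_projection[OF linear_subspace_image[OF lin subspace_UNIV]] by metis
    have "A (Q x) \<in> range (A ^^ Suc j)" for x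
      using Q(2)[of x] by auto
    then have PAQ: "P (A (Q x)) = A (Q x)" for x
      using Suc.prems(3) by blast
    have "range (A ^^ Suc j) \<subseteq> range (A ^^ j)"
      by (auto simp: funpow_swap1)
    then have QP: "Q (P x) = P x" for x
      using Q(3) Suc.prems(2) by blast
    have "endo_trace A = endo_trace (\<lambda>x. P (A (Q x)))"
      using Suc.IH[OF Q] PAQ by simp
    also have "\<dots> = endo_trace (\<lambda>x. A (Q (P x)))"
      using trace_cyclic[OF Suc.prems(1) linear_compose[OF Q(1) A]] by (simp add: o_def)
    finally show ?case by (simp add: QP)
  qed simp
  moreover obtain P where "linear P" "\<And>x. P x \<in> range (A ^^ k)" "\<And>x. x \<in> range (A ^^ k) \<Longrightarrow> P x = x"
    using ex_projection[OF linear_subspace_image[OF lin subspace_UNIV]] by metis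
  ultimately have "endo_trace A = endo_trace (\<lambda>x. A (P x))" by blast
  also have "P x = 0" for x
    using \<open>P x \<in> range (A ^^ k)\<close> nil by auto
  then have "(\<lambda>x. A (P x)) = (\<lambda>x. 0 *\<^sub>R x)" using linear_0[OF A] by simp
  then have "endo_trace (\<lambda>x. A (P x)) = 0"
    by (simp add: trace_formula linear_0 linear_zero g_simps)
  finally show ?thesis .
qed

end

section \<open>Self-adjoint endomorphisms and orthogonal splittings\<close>

context pseudo_orthonormal
begin

text \<open>The powers of \<open>T\<close> applied to one vector are linearly dependent; multiplying such dependences over a
spanning set gives a polynomial that works for all vectors.\<close>

lemma annihilating_polynomial:
  fixes T :: "'a \<Rightarrow> 'a"
  assumes T: "linear T"
  obtains m where "m \<noteq> 0" "\<And>v. poly_endo T m v = 0"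
proof -
  have "\<exists>p. p \<noteq> 0 \<and> poly_endo T p v = 0" for v
  proof (rule ccontr)
    assume *: "\<not> ?thesis"
    define f where "f i = (T ^^ i) v" for i
    have monom: "poly_endo T (monom a i) v = a *\<^sub>R f i" for a i
    proof (cases "a = 0")
      case False
      have "(\<Sum>j\<le>i. coeff (monom a i) j *\<^sub>R (T ^^ j) v) = (\<Sum>j\<le>i. if j = i then a *\<^sub>R (T ^^ i) v else 0)"
        by (intro sum.cong) auto
      then show ?thesis using False by (simp add: poly_endo_def f_def degree_monom_eq)
    qed simp
    have sum: "poly_endo T (\<Sum>i\<in>I. p i) v = (\<Sum>i\<in>I. poly_endo T (p i) v)" for p :: "nat \<Rightarrow> real poly" and I
      by (induction I rule: infinite_finite_induct) (simp_all add: poly_endo_add[OF T])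
    have inj: "inj f"
    proof (rule injI, rule ccontr)
      fix i j assume ij: "f i = f j" "i \<noteq> j"
      have "coeff (monom 1 i + monom (- 1 :: real) j) i = 1" using ij by simp
      then have "monom 1 i + monom (- 1 :: real) j \<noteq> 0" by (metis coeff_0 zero_neq_one)
      moreover have "poly_endo T (monom 1 i + monom (- 1) j) v = 0"
        using ij by (simp add: poly_endo_add[OF T] monom)
      ultimately show False using * by blast
    qed
    have "independent (f ` {..N})"
    proof (rule independent_if_scalars_zero)
      fix c x assume c: "(\<Sum>x\<in>f ` {..N}. c x *\<^sub>R x) = 0" and x: "x \<in> f ` {..N}"
      have "poly_endo T (\<Sum>i\<le>N. monom (c (f i)) i) v = 0"
        using c by (simp add: sum monom sum.reindex[OF inj_on_subset[OF inj]])
      then have 0: "(\<Sum>i\<le>N. monom (c (f i)) i) = 0" using * by blast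
      obtain i where i: "i \<le> N" "x = f i" using x by auto
      have "coeff (\<Sum>i\<le>N. monom (c (f i)) i) i = c (f i)"
        using i by (simp add: coeff_sum)
      then show "c x = 0" using i 0 by simp
    qed simp
    then have "card (f ` {..N}) \<le> card (e ` {..<N})"
      using independent_span_bound[of "e ` {..<N}" "f ` {..N}"] span_e by simp
    also have "\<dots> \<le> N" using card_image_le[of "{..<N}" e] by simp
    finally show False by (simp add: card_image[OF inj_on_subset[OF inj]])
  qed
  then obtain p where p: "\<And>v. p v \<noteq> 0" "\<And>v. poly_endo T (p v) v = 0" by metis
  \<comment> \<open>The product kills every basis vector, each through its own factor.\<close>
  define m where "m = (\<Prod>i<N. p (e i))"
  have "poly_endo T m (e i) = 0" if "i < N" for i
    by (rule poly_endo_dvd[OF T _ p(2)]) (use that dvd_prodI[of "{..<N}" i "\<lambda>i. p (e i)"] in \<open>simp add: m_def\<close>)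
  then have "poly_endo T m v = 0" for v
    using linear_eq_on_span[OF linear_poly_endo[OF T] linear_zero, of "e ` {..<N}" m v] span_e by auto
  moreover have "m \<noteq> 0" using p by (simp add: m_def)
  ultimately show ?thesis using that by blast
qed

lemma self_adjoint_poly_endo:
  assumes "linear T" "\<And>x y. g (T x) y = g x (T y)"
  shows "g (poly_endo T p x) y = g x (poly_endo T p y)"
  by (induction p arbitrary: x y) (simp_all add: poly_endo_pCons[OF assms(1)] g_simps assms(2)
      poly_endo_commute[OF assms(1)])

text \<open>By the Bezout identity \<open>x\<close> is a multiple of \<open>q(T)\<close> applied to itself, and self-adjointness moves \<open>q(T)\<close>
over to \<open>y\<close>.\<close>

lemma coprime_kernels_orthogonal:
  assumes T: "linear T" "\<And>x y. g (T x) y = g x (T y)" and pq: "coprime p q"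
    and x: "poly_endo T p x = 0" and y: "poly_endo T q y = 0"
  shows "g x y = 0"
proof -
  obtain a b where ab: "\<And>v. v = poly_endo T (a * p) v + poly_endo T (b * q) v"
    using coprime_kernel_split[OF T(1) pq] by blast
  have "x = poly_endo T (b * q) x"
    using ab[of x] poly_endo_mult_eq_0[OF T(1) x, of a] by simp
  then have "g x y = g x (poly_endo T (b * q) y)"
    using self_adjoint_poly_endo[OF T] by metis
  then show ?thesis using poly_endo_mult_eq_0[OF T(1) y, of b] by (simp add: g_simps)
qed

text \<open>Existence of the decomposition is the kernel decomposition for coprime factors. For uniqueness, the
difference of two components with the same index is orthogonal to all of the space: to the other
summands because the summands are orthogonal, and to its own summand because the differences add up to
zero.\<close>

lemma splits_orthogonally_kernels:
  assumes T: "linear T" "\<And>x y. g (T x) y = g x (T y)"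
    and co: "sorted_wrt coprime ps" and ann: "\<And>v. poly_endo T (prod_list ps) v = 0"
  shows "splits_orthogonally g (map (\<lambda>p. {v. poly_endo T p v = 0}) ps)"
proof -
  let ?W = "\<lambda>p. {v. poly_endo T p v = 0}"
  let ?Ws = "map ?W ps"
  have orth: "g x y = 0" if ij: "i < length ps" "j < length ps" "i \<noteq> j"
      and xy: "x \<in> ?W (ps ! i)" "y \<in> ?W (ps ! j)" for i j x y
  proof -
    have "coprime (ps ! i) (ps ! j)"
      using co ij unfolding sorted_wrt_iff_nth_less by (metis coprime_commute linorder_neqE_nat)
    then show ?thesis using coprime_kernels_orthogonal[OF T] xy by simp
  qed
  have uniq: "xs = ys" if xs: "list_all2 (\<in>) xs ?Ws" and ys: "list_all2 (\<in>) ys ?Ws"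
    and eq: "sum_list xs = sum_list ys" for xs ys
  proof (rule nth_equalityI)
    show len: "length xs = length ys" using xs ys by (simp add: list_all2_lengthD)
    fix i assume i: "i < length xs"
    have l: "length xs = length ps" "length ys = length ps"
      using list_all2_lengthD[OF xs] list_all2_lengthD[OF ys] by simp_all
    have mem: "xs ! j \<in> ?W (ps ! j)" "ys ! j \<in> ?W (ps ! j)" if "j < length ps" for j
      using list_all2_nthD2[OF xs, of j] list_all2_nthD2[OF ys, of j] that by simp_all
    have d: "xs ! j - ys ! j \<in> ?W (ps ! j)" if "j < length ps" for j
      using mem[OF that] by (simp add: linear_diff[OF linear_poly_endo[OF T(1)]])
    have s0: "(\<Sum>j<length ps. xs ! j - ys ! j) = 0"
      using eq l by (simp add: sum_list_sum_nth sum_subtractf atLeast0LessThan)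
    have "g (xs ! i - ys ! i) w = 0" for w
    proof -
      obtain ws where ws: "list_all2 (\<lambda>x p. poly_endo T p x = 0) ws ps" "sum_list ws = w"
        using kernel_sum_of_coprime_factors[OF T(1) co ann] by blast
      have lw: "length ws = length ps" using list_all2_lengthD[OF ws(1)] .
      have wm: "ws ! j \<in> ?W (ps ! j)" if "j < length ps" for j
        using list_all2_nthD2[OF ws(1) that] by simp
      have "g (xs ! i - ys ! i) w = (\<Sum>j<length ps. g (xs ! i - ys ! i) (ws ! j))"
        unfolding ws(2)[symmetric] sum_list_sum_nth atLeast0LessThan lw g_sum_right ..
      also have "\<dots> = (\<Sum>j<length ps. if j = i then g (xs ! i - ys ! i) (ws ! i) else 0)"
        using i l orth[OF _ _ _ d wm] by (intro sum.cong) auto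
      also have "\<dots> = g (xs ! i - ys ! i) (ws ! i)" using i l by simp
      also have "\<dots> = (\<Sum>j<length ps. if j = i then g (xs ! i - ys ! i) (ws ! i) else 0)"
        using i l by simp
      also have "\<dots> = (\<Sum>j<length ps. g (xs ! j - ys ! j) (ws ! i))"
        using i l orth[OF _ _ _ d wm] by (intro sum.cong) auto
      also have "\<dots> = 0" unfolding g_sum_left[symmetric] s0 by (simp add: g_simps)
      finally show ?thesis .
    qed
    then have "xs ! i - ys ! i = 0" by (rule nondegenerate)
    then show "xs ! i = ys ! i" by simp
  qed
  have "\<exists>!xs. list_all2 (\<in>) xs ?Ws \<and> sum_list xs = v" for v
    using kernel_sum_of_coprime_factors[OF T(1) co ann[of v]] uniq
    by (fastforce simp: list_all2_map2)
  moreover have "subspace (?W p)" for p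
    using linear_subspace_vimage[OF linear_poly_endo[OF T(1)] subspace_single_0] 
    by (simp add: vimage_def)
  ultimately show ?thesis
    using orth by (auto simp: splits_orthogonally_def)
qed

text \<open>A vector that is not orthogonal to \<open>x\<close> stays so when projected to the kernel of \<open>p\<close>, since the part
removed lies in the orthogonal kernel of \<open>q\<close>.\<close>

lemma coprime_kernel_nondegenerate:
  assumes T: "linear T" "\<And>x y. g (T x) y = g x (T y)" and pq: "coprime p q"
    and ann: "\<And>v. poly_endo T (p * q) v = 0"
    and x: "poly_endo T p x = 0" "x \<noteq> 0"
  obtains y where "poly_endo T p y = 0" "g x y \<noteq> 0"
proof -
  obtain a b where ab: "\<And>v. v = poly_endo T (a * p) v + poly_endo T (b * q) v"
    using coprime_kernel_split[OF T(1) pq] by blast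
  obtain y where y: "g x y \<noteq> 0" using nondegenerate x(2) by blast
  have "g x (poly_endo T (a * p) y) = g (poly_endo T (a * p) x) y"
    by (simp add: self_adjoint_poly_endo[OF T])
  also have "\<dots> = 0"
    by (simp add: poly_endo_mult_eq_0[OF T(1) x(1)] g_simps)
  finally have "g x (poly_endo T (b * q) y) \<noteq> 0"
    using y ab[of y] by (metis add_0 bilinear_radd[OF bilinear])
  moreover have "poly_endo T p (poly_endo T (b * q) y) = poly_endo T (b * (p * q)) y"
    by (simp flip: poly_endo_mult[OF T(1)] add: ac_simps)
  then have "poly_endo T p (poly_endo T (b * q) y) = 0"
    by (simp add: poly_endo_mult_eq_0[OF T(1) ann])
  ultimately show ?thesis using that by blast
qed

lemma finite_eigenvalues:
  assumes T: "linear (T :: 'a \<Rightarrow> 'a)"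
  shows "finite (eigenvalues T)"
proof -
  obtain m where m: "m \<noteq> 0" "\<And>v. poly_endo T m v = 0"
    using annihilating_polynomial[OF T] by blast
  have "map_poly complex_of_real m \<noteq> 0" using m(1) by (simp add: map_poly_eq_0_iff)
  then have "finite {z. cpoly m z = 0}" by (rule poly_roots_finite)
  moreover have "eigenvalues T \<subseteq> {z. cpoly m z = 0}"
    using eigenvalue_is_root[OF T m(2)] by blast
  ultimately show ?thesis by (rule finite_subset[rotated])
qed

end

section \<open>The exterior square as a space of endomorphisms\<close>

lemma wedge_space_sum:
  fixes m :: nat
  shows "(\<And>i. i < m \<Longrightarrow> u i \<in> W \<and> v i \<in> W) \<Longrightarrow> (\<lambda>x. \<Sum>i<m. wedge g (u i) (v i) x) \<in> wedge_space g W"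
  unfolding wedge_space_def by (intro CollectI exI[of _ m] exI[of _ u] exI[of _ v]) auto

lemma wedge_in_wedge_space: "u \<in> W \<Longrightarrow> v \<in> W \<Longrightarrow> wedge g u v \<in> wedge_space g W"
  using wedge_space_sum[of 1 "\<lambda>_. u" W "\<lambda>_. v" g] by (simp add: lessThan_Suc)

lemma zero_in_wedge_space: "(\<lambda>x. 0) \<in> wedge_space g W"
  unfolding wedge_space_def by (intro CollectI exI[of _ 0]) auto

lemma add_in_wedge_space:
  assumes "A \<in> wedge_space g W" "B \<in> wedge_space g W"
  shows "(\<lambda>x. A x + B x) \<in> wedge_space g W"
proof -
  obtain m u v where A: "\<forall>i<m. u i \<in> W \<and> v i \<in> W" "A = (\<lambda>x. \<Sum>i<m::nat. wedge g (u i) (v i) x)"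
    using assms(1) unfolding wedge_space_def by blast
  obtain m' u' v' where B: "\<forall>i<m'. u' i \<in> W \<and> v' i \<in> W" "B = (\<lambda>x. \<Sum>i<m'::nat. wedge g (u' i) (v' i) x)"
    using assms(2) unfolding wedge_space_def by blast
  let ?u = "\<lambda>i. if i < m then u i else u' (i - m)"
  let ?v = "\<lambda>i. if i < m then v i else v' (i - m)"
  have "(\<Sum>i<m + m'. wedge g (?u i) (?v i) x) = A x + B x" for x
  proof -
    have "(\<Sum>i<m + m'. wedge g (?u i) (?v i) x) =
        (\<Sum>i<m. wedge g (?u i) (?v i) x) + (\<Sum>i<m'. wedge g (?u (m + i)) (?v (m + i)) x)"
      by (induction m') (simp_all add: add.assoc)
    then show ?thesis by (simp add: A B)
  qed
  moreover have "(\<lambda>x. \<Sum>i<m + m'. wedge g (?u i) (?v i) x) \<in> wedge_space g W"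
    by (rule wedge_space_sum) (use A B in auto)
  ultimately show ?thesis by simp
qed

text \<open>Lets linear statements about the exterior square be checked on decomposable elements.\<close>

lemma wedge_space_induct [consumes 1, case_names zero add]:
  assumes A: "A \<in> wedge_space g W"
    and z: "P (\<lambda>x. 0)"
    and a: "\<And>u v B. u \<in> W \<Longrightarrow> v \<in> W \<Longrightarrow> B \<in> wedge_space g W \<Longrightarrow> P B \<Longrightarrow> P (\<lambda>x. B x + wedge g u v x)"
  shows "P A"
proof -
  obtain m u v where uv: "\<forall>i<m. u i \<in> W \<and> v i \<in> W" "A = (\<lambda>x. \<Sum>i<m::nat. wedge g (u i) (v i) x)"
    using A unfolding wedge_space_def by blast
  have "k \<le> m \<Longrightarrow> P (\<lambda>x. \<Sum>i<k. wedge g (u i) (v i) x)" for k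
  proof (induction k)
    case (Suc k)
    then show ?case
      using a[OF _ _ wedge_space_sum[of k u W v g], of "u k" "v k"] uv by simp
  qed (simp add: z)
  then show ?thesis using uv by blast
qed

lemma wedge_space_mono: "W \<subseteq> W' \<Longrightarrow> wedge_space g W \<subseteq> wedge_space g W'"
  unfolding wedge_space_def by blast

section \<open>The Ricci operator of a semi-symmetric curvature tensor\<close>

locale semi_symmetric = pseudo_orthonormal +
  fixes K
  assumes semi_symmetric: "semi_symmetric_on g UNIV K"
begin

abbreviation R where "R u v \<equiv> K (wedge g u v)"
abbreviation T where "T \<equiv> Ric g K"

lemmas curvature_tensor = semi_symmetric[unfolded semi_symmetric_on_def curvature_tensor_on_def]

lemma skew_in_wedge_space:
  assumes "A \<in> wedge_space g UNIV"
  shows "linear A" "g (A x) y = - g x (A y)"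
proof -
  have "linear A \<and> (\<forall>x y. g (A x) y = - g x (A y))"
    using assms
  proof (induction rule: wedge_space_induct)
    case zero
    then show ?case by (simp add: linear_zero g_simps)
  next
    case (add u v B)
    have "linear (wedge g u v)"
      by (rule linearI) (simp_all add: wedge_def g_simps algebra_simps)
    then have "linear (\<lambda>x. B x + wedge g u v x)" using add by (simp add: linear_compose_add)
    moreover have "g (wedge g u v x) y = - g x (wedge g u v y)" for x y
      using sym[of x u] sym[of x v] by (simp add: wedge_def g_simps)
    ultimately show ?case using add by (simp add: g_simps)
  qed
  then show "linear A" "g (A x) y = - g x (A y)" by blast+
qed

lemma wedge_in: "wedge g u v \<in> wedge_space g UNIV"
  by (simp add: wedge_in_wedge_space)

lemma K_in: "A \<in> wedge_space g UNIV \<Longrightarrow> K A \<in> wedge_space g UNIV"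
  using curvature_tensor by blast

lemma K_add: "A \<in> wedge_space g UNIV \<Longrightarrow> B \<in> wedge_space g UNIV \<Longrightarrow>
    K (\<lambda>x. A x + B x) = (\<lambda>x. K A x + K B x)"
  using curvature_tensor by blast

lemma K_scale: "A \<in> wedge_space g UNIV \<Longrightarrow> K (\<lambda>x. c *\<^sub>R A x) = (\<lambda>x. c *\<^sub>R K A x)"
  using curvature_tensor by blast

lemma K_zero: "K (\<lambda>x. 0) = (\<lambda>x. 0)"
  using K_scale[OF zero_in_wedge_space, of 0] by simp

lemma linear_R: "linear (R u v)" and R_skew: "g (R u v x) y = - g x (R u v y)"
  using skew_in_wedge_space[OF K_in[OF wedge_in]] by blast+

lemma R_self: "R u u x = 0"
proof -
  have "wedge g u u = (\<lambda>x. 0)" by (simp add: wedge_def)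
  then show ?thesis using K_zero by simp
qed

lemma linear_R1: "linear (\<lambda>u. R u v x)" and linear_R2: "linear (\<lambda>v. R u v x)"
proof -
  have add1: "wedge g (u + u') v = (\<lambda>x. wedge g u v x + wedge g u' v x)" for u u' v
    by (simp add: wedge_def g_simps algebra_simps)
  have scale1: "wedge g (c *\<^sub>R u) v = (\<lambda>x. c *\<^sub>R wedge g u v x)" for c u v
    by (simp add: wedge_def g_simps algebra_simps)
  have add2: "wedge g v (u + u') = (\<lambda>x. wedge g v u x + wedge g v u' x)" for u u' v
    by (simp add: wedge_def g_simps algebra_simps)
  have scale2: "wedge g v (c *\<^sub>R u) = (\<lambda>x. c *\<^sub>R wedge g v u x)" for c u v
    by (simp add: wedge_def g_simps algebra_simps)
  show "linear (\<lambda>u. R u v x)" "linear (\<lambda>v. R u v x)"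
    by (rule linearI; simp add: add1 add2 scale1 scale2 K_add[OF wedge_in wedge_in] K_scale[OF wedge_in])+
qed

lemma R_antisym: "R u v x = - R v u x"
proof -
  have "R (u + v) (u + v) x = R u u x + R v v x + (R u v x + R v u x)"
    by (simp add: linear_add[OF linear_R1] linear_add[OF linear_R2])
  then show ?thesis by (simp add: R_self eq_neg_iff_add_eq_0)
qed

text \<open>For a skew endomorphism \<open>A\<close> the product with \<open>a \<and> b\<close> is a matrix coefficient of \<open>A\<close>, so the
symmetry of \<open>K\<close> turns into the pair symmetry of the curvature in the next lemma.\<close>

lemma wedge_product_eq:
  assumes A: "linear A" "\<And>x y. g (A x) y = - g x (A y)"
  shows "wedge_product A (wedge g a b) = g (A a) b"
proof -
  have "A \<circ> wedge g a b = (\<lambda>x. g b x *\<^sub>R A a - g a x *\<^sub>R A b)"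
    by (simp add: fun_eq_iff wedge_def linear_diff[OF A(1)] linear_scale[OF A(1)])
  then have "endo_trace (A \<circ> wedge g a b) = g b (A a) - g a (A b)"
    by (simp add: endo_trace_diff trace_rank_one[OF linear_g])
  then show ?thesis
    using A(2)[of a b] by (simp add: wedge_product_def sym[of b])
qed

lemma R_pair_sym: "g (R u v a) b = g (R a b u) v"
proof -
  have "g (R u v a) b = wedge_product (R u v) (wedge g a b)"
    by (rule wedge_product_eq[symmetric, OF linear_R R_skew])
  also have "\<dots> = wedge_product (wedge g u v) (R a b)"
    using curvature_tensor wedge_in by blast
  also have "\<dots> = wedge_product (R a b) (wedge g u v)"
    unfolding wedge_product_def o_def
    by (simp add: trace_cyclic[OF skew_in_wedge_space(1)[OF wedge_in] linear_R])
  also have "\<dots> = g (R a b u) v"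
    by (rule wedge_product_eq[OF linear_R R_skew])
  finally show ?thesis .
qed

lemma bianchi: "R u v w + R v w u + R w u v = 0"
  using curvature_tensor by blast

lemma R_commutator: "R u v (R a b x) - R a b (R u v x) = R (R u v a) b x + R a (R u v b) x"
  using curvature_tensor unfolding commutator_def fun_eq_iff by blast

lemma linear_ric: "linear (ric g K u)"
  unfolding ric_def trace_formula[OF linear_R2]
  by (rule linearI)
    (simp_all add: linear_add[OF linear_R] linear_scale[OF linear_R] g_simps algebra_simps
      sum.distrib sum_distrib_left)

text \<open>Nondegeneracy makes the description defining the Ricci operator meaningful; the representing vector is
written in the orthonormal basis.\<close>

lemma g_T_eq_ric: "g (T u) v = ric g K u v"
proof -
  let ?w = "\<Sum>i<N. (\<epsilon> i * ric g K u (e i)) *\<^sub>R e i"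
  have w: "g ?w v = ric g K u v" for v
  proof -
    have "ric g K u v = ric g K u (\<Sum>i<N. (\<epsilon> i * g v (e i)) *\<^sub>R e i)"
      unfolding expand[symmetric] ..
    also have "\<dots> = g ?w v"
      by (simp add: linear_sum[OF linear_ric] linear_scale[OF linear_ric] g_sum_left g_simps sym[of v] ac_simps)
    finally show ?thesis by simp
  qed
  have "\<forall>v. g (T u) v = ric g K u v"
    unfolding Ric_def by (rule theI[of _ ?w]) (use w eq_if_g_eq in auto)
  then show ?thesis by blast
qed

text \<open>By the pair symmetry, \<open>a \<mapsto> R u a v\<close> and \<open>a \<mapsto> R v a u\<close> are adjoint to each other and have the same
trace.\<close>

lemma T_self_adjoint: "g (T u) v = g u (T v)"
proof -
  have "endo_trace (\<lambda>a. R u a v) = endo_trace (\<lambda>a. R v a u)"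
    by (rule trace_adjoint[OF linear_R2 linear_R2]) (metis R_pair_sym sym)
  then show ?thesis using sym[of u] by (simp add: g_T_eq_ric ric_def)
qed

lemma linear_T: "linear T"
  by (rule linearI; rule eq_if_g_eq)
    (simp_all add: T_self_adjoint g_simps)

text \<open>Semi-symmetry says that \<open>A = R u v\<close> is a derivation of the curvature. Applying \<open>A\<close> to the Ricci form
therefore gives the trace of a commutator, which is zero.\<close>

lemma T_commutes_with_R: "T (R u v w) = R u v (T w)"
proof (rule eq_if_g_eq)
  fix y
  define A where "A = R u v"
  have lA: "linear A" by (simp add: A_def linear_R)
  let ?M = "\<lambda>a. R w a y"
  have M: "R (A w) a y + R w a (A y) = A (?M a) - ?M (A a)" for a
    using R_commutator[of u v w a y] by (simp add: A_def algebra_simps)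
  have "ric g K (A w) y + ric g K w (A y) = endo_trace (\<lambda>a. A (?M a)) - endo_trace (\<lambda>a. ?M (A a))"
  proof -
    have "ric g K (A w) y + ric g K w (A y) = endo_trace (\<lambda>a. R (A w) a y + R w a (A y))"
      unfolding ric_def
      by (simp add: trace_formula[OF linear_R2] trace_formula[OF linear_compose_add[OF linear_R2 linear_R2]]
          g_simps algebra_simps sum.distrib)
    then show ?thesis by (simp add: M endo_trace_diff)
  qed
  also have "\<dots> = 0" by (simp add: trace_cyclic[OF lA linear_R2])
  finally have "g (T (A w)) y + g (T w) (A y) = 0" by (simp add: g_T_eq_ric)
  then show "g (T (R u v w)) y = g (R u v (T w)) y"
    by (simp add: A_def R_skew[of u v "T w" y])
qed

end

section \<open>Endomorphisms commuting with the curvature\<close>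

context semi_symmetric
begin

text \<open>The self-adjoint part of the commutant of the curvature endomorphisms.\<close>

definition symmetric_intertwiner where
  "symmetric_intertwiner P \<longleftrightarrow> linear P \<and> (\<forall>x y. g (P x) y = g x (P y)) \<and>
    (\<forall>u v w. P (R u v w) = R u v (P w))"

lemma symmetric_intertwiner_poly: "symmetric_intertwiner (poly_endo T p)"
proof -
  have "poly_endo T p (R u v w) = R u v (poly_endo T p w)" for u v w
    by (induction p arbitrary: w)
      (simp_all add: poly_endo_pCons[OF linear_T] T_commutes_with_R linear_0[OF linear_R] linear_add[OF linear_R]
        linear_scale[OF linear_R])
  then show ?thesis
    unfolding symmetric_intertwiner_def
    using linear_poly_endo[OF linear_T] self_adjoint_poly_endo[OF linear_T T_self_adjoint] by blast
qed

text \<open>Pair symmetry gives \<open>R (P u) v = R u (P v)\<close>. So the defect \<open>D u v w = R (P u) v w - P (R u v w)\<close> is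
skew in \<open>u, v\<close>. Subtracting the Bianchi identity composed with \<open>P\<close> from the one at \<open>P u, v, w\<close> shows that \<open>D\<close> is
symmetric in \<open>v, w\<close>. A trilinear map that is skew in the first and symmetric in the last two arguments
vanishes.\<close>

lemma R_intertwiner:
  assumes "symmetric_intertwiner P"
  shows "R (P u) v w = P (R u v w)" "R u (P v) w = P (R u v w)"
proof -
  have P: "linear P" "\<And>x y. g (P x) y = g x (P y)" "\<And>u v w. P (R u v w) = R u v (P w)"
    using assms unfolding symmetric_intertwiner_def by blast+
  have move: "R (P u) v w = R u (P v) w" for u v w
  proof (rule eq_if_g_eq)
    fix y
    show "g (R (P u) v w) y = g (R u (P v) w) y"
      by (simp add: R_pair_sym[of _ _ w y] flip: P(2,3))
  qed
  define D where "D u v w = R (P u) v w - P (R u v w)" for u v w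
  have D_antisym: "D u v w = - D v u w" for u v w
    using R_antisym[of "P u" v w] R_antisym[of u v w] move[of v u w]
    by (simp add: D_def linear_neg[OF P(1)])
  have D_sym: "D u v w = D u w v" for u v w
  proof -
    have "P (R u v w) + P (R v w u) + P (R w u v) = 0"
      by (simp add: bianchi linear_0[OF P(1)] flip: linear_add[OF P(1)])
    moreover have "R (P u) v w + P (R v w u) + R w (P u) v = 0"
      using bianchi[of "P u" v w] by (simp add: P(3))
    moreover have "D u v w + (R w (P u) v - P (R w u v)) =
        (R (P u) v w + P (R v w u) + R w (P u) v) - (P (R u v w) + P (R v w u) + P (R w u v))"
      by (simp add: D_def)
    ultimately have "D u v w + (R w (P u) v - P (R w u v)) = 0" by simp
    then have "D u v w = - (R w (P u) v - P (R w u v))"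
      by (rule eq_neg_iff_add_eq_0[THEN iffD2])
    also have "\<dots> = D u w v"
      using R_antisym[of w "P u" v] R_antisym[of w u v] by (simp add: D_def linear_neg[OF P(1)])
    finally show ?thesis .
  qed
  \<comment> \<open>Six transpositions, alternately of the first and of the last two arguments, restore the order;
      only the three of the first kind change the sign.\<close>
  have "D u v w = - D u v w"
    using D_antisym[of u v w] D_sym[of v u w] D_antisym[of v w u] D_sym[of w v u]
      D_antisym[of w u v] D_sym[of u w v] by simp
  then have "2 *\<^sub>R D u v w = 0" by (metis scaleR_2 add.right_inverse)
  then have "D u v w = 0" by simp
  then show "R (P u) v w = P (R u v w)" by (simp add: D_def)
  then show "R u (P v) w = P (R u v w)" by (simp add: move)
qed

text \<open>The Ricci form at \<open>P u\<close> is the trace of \<open>P \<circ> M\<close> with \<open>M a = R u a y\<close>. As \<open>M\<close> commutes with \<open>P\<close>, the composition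
is nilpotent together with \<open>P\<close>.\<close>

lemma T_nilpotent_intertwiner:
  assumes P: "symmetric_intertwiner P" and nil: "\<And>x. (P ^^ k) x = 0"
  shows "T (P u) = 0"
proof (rule nondegenerate)
  fix y
  have lP: "linear P" using P unfolding symmetric_intertwiner_def by blast
  define M where "M a = R u a y" for a
  have lM: "linear M" unfolding M_def by (rule linear_R2)
  have comm: "M ((P ^^ j) a) = (P ^^ j) (M a)" for j a
    by (induction j) (simp_all add: M_def R_intertwiner(2)[OF P])
  have "((\<lambda>a. P (M a)) ^^ j) a = (P ^^ j) ((M ^^ j) a)" for j a
    by (induction j) (simp_all add: comm)
  then have "endo_trace (\<lambda>a. P (M a)) = 0"
    using linear_compose[OF lM lP] nil by (intro trace_nilpotent[of _ k]) (simp_all add: o_def)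
  then show "g (T (P u)) y = 0"
    by (simp add: g_T_eq_ric ric_def R_intertwiner(1)[OF P] M_def)
qed

text \<open>All identities are inherited by a subspace \<open>W\<close>; what has to be shown is that \<open>K\<close> maps the exterior square
of \<open>W\<close> to itself. For \<open>u\<close> in \<open>W\<close>, the endomorphism \<open>R u v\<close> is unchanged by composition with the projection \<open>P\<close>
on either side. Any skew \<open>A\<close> is \<open>(\<Sum>i<N. \<epsilon> i A (e i) \<and> e i) / 2\<close>, and inserting \<open>P\<close> on both sides puts all
terms of this sum into \<open>W\<close>.\<close>

lemma semi_symmetric_on_range_of_intertwiner:
  assumes P: "symmetric_intertwiner P" and W: "\<And>x. P x \<in> W" "\<And>x. x \<in> W \<Longrightarrow> P x = x"
  shows "semi_symmetric_on g W K"
proof -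
  have P': "linear P" "\<And>x y. g (P x) y = g x (P y)" "\<And>u v w. P (R u v w) = R u v (P w)"
    using P unfolding symmetric_intertwiner_def by blast+
  have sW: "subspace W"
  proof -
    have "W = range P" by (rule set_eqI) (metis W rangeE rangeI)
    then show ?thesis using linear_subspace_image[OF P'(1) subspace_UNIV] by simp
  qed
  have RW: "R u v \<in> wedge_space g W" if "u \<in> W" "v \<in> W" for u v
  proof -
    have PR: "P (R u v x) = R u v x" for x
      using R_intertwiner(1)[OF P, of u v x] W(2)[OF that(1)] by simp
    let ?f = "\<lambda>x. \<Sum>i<N. wedge g ((\<epsilon> i / 2) *\<^sub>R R u v (e i)) (P (e i)) x"
    have "R u v x = ?f x" for x
    proof -
      have 2: "(\<Sum>i<N. (\<epsilon> i * g (P x) (e i)) *\<^sub>R R u v (e i)) = R u v x"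
      proof -
        have "R u v x = R u v (\<Sum>i<N. (\<epsilon> i * g (P x) (e i)) *\<^sub>R e i)"
          unfolding expand[symmetric] using P'(3) PR by simp
        then show ?thesis
          by (simp add: linear_sum[OF linear_R] linear_scale[OF linear_R])
      qed
      have 3: "(\<Sum>i<N. (\<epsilon> i * g (R u v x) (e i)) *\<^sub>R P (e i)) = R u v x"
      proof -
        have "R u v x = P (\<Sum>i<N. (\<epsilon> i * g (R u v x) (e i)) *\<^sub>R e i)"
          unfolding expand[symmetric] PR ..
        then show ?thesis
          by (simp add: linear_sum[OF P'(1)] linear_scale[OF P'(1)])
      qed
      have "?f x = (\<Sum>i<N. (1/2) *\<^sub>R ((\<epsilon> i * g (P x) (e i)) *\<^sub>R R u v (e i)) +
          (1/2) *\<^sub>R ((\<epsilon> i * g (R u v x) (e i)) *\<^sub>R P (e i)))"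
      proof (rule sum.cong[OF refl])
        fix i
        have "g (P (e i)) x = g (P x) (e i)" "g (R u v (e i)) x = - g (R u v x) (e i)"
          using P'(2) sym R_skew[of u v "e i" x] by (metis, metis)
        then show "wedge g ((\<epsilon> i / 2) *\<^sub>R R u v (e i)) (P (e i)) x =
          (1/2) *\<^sub>R ((\<epsilon> i * g (P x) (e i)) *\<^sub>R R u v (e i)) +
          (1/2) *\<^sub>R ((\<epsilon> i * g (R u v x) (e i)) *\<^sub>R P (e i))"
          by (simp add: wedge_def g_simps mult.commute)
      qed
      also have "\<dots> = (1/2) *\<^sub>R R u v x + (1/2) *\<^sub>R R u v x"
        by (simp only: sum.distrib scaleR_sum_right[symmetric] 2 3)
      also have "\<dots> = R u v x" by (simp flip: scaleR_left_distrib)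
      finally show ?thesis ..
    qed
    then have "R u v = ?f" by (rule ext)
    also have "?f \<in> wedge_space g W"
      by (rule wedge_space_sum) (use W(1) PR subspace_scale[OF sW] in metis)
    finally show ?thesis .
  qed
  have sub: "wedge_space g W \<subseteq> wedge_space g UNIV" by (rule wedge_space_mono) simp
  have "K A \<in> wedge_space g W" if "A \<in> wedge_space g W" for A
    using that
  proof (induction rule: wedge_space_induct)
    case zero
    then show ?case by (simp add: K_zero zero_in_wedge_space)
  next
    case (add u v B)
    then have "K (\<lambda>x. B x + wedge g u v x) = (\<lambda>x. K B x + R u v x)"
      using sub by (intro K_add[OF _ wedge_in]) blast
    then show ?case using add_in_wedge_space[OF add.IH RW[OF add.hyps(1,2)]] by simp
  qed
  then show ?thesis
    using curvature_tensor sub unfolding semi_symmetric_on_def curvature_tensor_on_def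
    by (auto dest!: subsetD[OF sub])
qed

end

section \<open>The primary decomposition of the Ricci operator\<close>

lemma distinct_sorted_wrt: "distinct xs \<longleftrightarrow> sorted_wrt (\<noteq>) xs"
  by (induction xs) auto

context semi_symmetric
begin

text \<open>Suppose \<open>F * l * m\<close> annihilates \<open>T\<close>, where \<open>l\<close> is the minimal polynomial of \<open>z\<close>. If \<open>z\<close> is not an eigenvalue,
then \<open>l(T)\<close> is injective and can be cancelled. Otherwise \<open>l\<close> divides \<open>F\<close>, so \<open>P = (F * m)(T)\<close> has square
zero and \<open>T \<circ> P = 0\<close>: the factor \<open>l\<close> has been exchanged for one factor \<open>X\<close>. That factor can be cancelled as
well, because \<open>X\<^sup>2\<close> divides \<open>F\<close>: writing \<open>F = X\<^sup>2 G\<close>, the endomorphism \<open>(X * G * m)(T)\<close> has cube zero and is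
thus killed by \<open>T\<close>.\<close>

lemma cancel_factor:
  assumes X: "[:0, 0, 1:] dvd F" and ev: "\<And>z. z \<in> eigenvalues T \<Longrightarrow> min_real_poly z dvd F"
    and ann: "\<And>v. poly_endo T (F * (min_real_poly z * m)) v = 0"
  shows "poly_endo T (F * m) v = 0"
proof -
  note [simp] = poly_endo_mult_eq_0[OF linear_T]
  have cancel_X: "poly_endo T (F * k) v = 0"
    if k: "\<And>v. poly_endo T ([:0, 1:] * (F * k)) v = 0" for k v
  proof -
    obtain G where G: "F = [:0, 1:] * ([:0, 1:] * G)"
      using X by (auto simp: dvd_def)
    let ?P = "poly_endo T ([:0, 1:] * (G * k))"
    have "(?P ^^ 3) v = poly_endo T (G * k * (G * k) * ([:0, 1:] * (F * k))) v" for v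
      by (simp add: G numeral_3_eq_3 ac_simps flip: poly_endo_mult[OF linear_T])
    also have "\<dots> v = 0" for v using k by (simp del: mult_pCons_left)
    finally have "T (?P v) = 0"
      by (rule T_nilpotent_intertwiner[OF symmetric_intertwiner_poly])
    moreover have "T w = poly_endo T [:0, 1:] w" for w
      by (simp add: poly_endo_pCons[OF linear_T] linear_0[OF linear_T])
    ultimately show ?thesis
      by (simp add: G ac_simps flip: poly_endo_mult[OF linear_T])
  qed
  show ?thesis
  proof (cases "z \<in> eigenvalues T")
    case False
    have "poly_endo T (min_real_poly z) (poly_endo T (F * m) v) = 0"
      using ann[of v] by (simp add: ac_simps flip: poly_endo_mult[OF linear_T])
    then show ?thesis using False eigenvalues_iff[OF linear_T] by blast
  next
    case True
    then obtain G where G: "F = min_real_poly z * G" using ev by (auto simp: dvd_def)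
    let ?P = "poly_endo T (F * m)"
    have "(?P ^^ 2) v = poly_endo T (G * m * (F * (min_real_poly z * m))) v" for v
      by (simp add: G numeral_2_eq_2 ac_simps flip: poly_endo_mult[OF linear_T])
    also have "\<dots> v = 0" for v using ann by simp
    finally have "T (?P v) = 0" for v
      by (rule T_nilpotent_intertwiner[OF symmetric_intertwiner_poly])
    then have "poly_endo T ([:0, 1:] * (F * m)) v = 0" for v
      by (simp add: poly_endo_mult[OF linear_T] poly_endo_pCons[OF linear_T] linear_0[OF linear_T])
    then show ?thesis by (rule cancel_X)
  qed
qed

text \<open>Starting from \<open>F * m\<close> for any annihilating polynomial \<open>m\<close>, the irreducible factors of \<open>m\<close> are
cancelled one by one.\<close>

lemma annihilated_by_eigenvalues:
  assumes X: "[:0, 0, 1:] dvd F" and ev: "\<And>z. z \<in> eigenvalues T \<Longrightarrow> min_real_poly z dvd F"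
  shows "poly_endo T F v = 0"
proof -
  have "poly_endo T F v = 0" if "m \<noteq> 0" "\<And>v. poly_endo T (F * m) v = 0" for m v
    using that
  proof (induction "degree m" arbitrary: m v rule: less_induct)
    case less
    show ?case
    proof (cases "degree m = 0")
      case True
      then obtain c where "m = [:c:]" by (meson degree_eq_zeroE)
      with less.prems show ?thesis by (simp add: poly_endo_smult[OF linear_T])
    next
      case False
      then obtain z k where m: "m = min_real_poly z * k"
        using real_poly_factor by (metis dvd_def)
      have "degree k < degree m"
        using less.prems(1) degree_min_real_poly[of z] unfolding m
        by (subst degree_mult_eq) auto
      moreover have "poly_endo T (F * k) v = 0" for v
        using cancel_factor[OF X ev] less.prems(2) unfolding m by blast
      ultimately show ?thesis using less.hyps[of k] less.prems(1) m by auto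
    qed
  qed
  moreover obtain m where "m \<noteq> 0" "\<And>v. poly_endo T m v = 0"
    using annihilating_polynomial[OF linear_T] by blast
  ultimately show ?thesis using poly_endo_mult_eq_0[OF linear_T] by blast
qed

text \<open>With the eigenvalues \<open>us\<close> in the upper half plane and the non-zero real eigenvalues \<open>\<alpha>s\<close>, these are
the pairwise coprime factors of a polynomial that annihilates \<open>T\<close>. Conjugate eigenvalues share one factor.\<close>

definition primary_factors :: "complex list \<Rightarrow> real list \<Rightarrow> real poly list" where
  "primary_factors us \<alpha>s =
    map min_real_poly us @ [:0, 0, 1:] # map (\<lambda>a. min_real_poly (of_real a)) \<alpha>s"

lemma primary_factors:
  assumes us: "distinct us" "set us = {z \<in> eigenvalues T. Im z > 0}"
    and as: "distinct \<alpha>s" "set \<alpha>s = nonzero_real_eigenvalues T"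
  shows "sorted_wrt coprime (primary_factors us \<alpha>s)"
    and "poly_endo T (prod_list (primary_factors us \<alpha>s)) v = 0"
proof -
  have X2: "cpoly [:0, 0, 1:] z = 0 \<longleftrightarrow> z = 0" for z
    by (simp add: map_poly_pCons)
  have "sorted_wrt coprime (map min_real_poly us)"
    unfolding sorted_wrt_map
    by (rule sorted_wrt_mono_rel[OF _ distinct_sorted_wrt[THEN iffD1, OF us(1)]])
      (use us(2) in \<open>auto intro!: coprime_min_real_poly\<close>)
  moreover have "sorted_wrt coprime (map (\<lambda>a. min_real_poly (of_real a)) \<alpha>s)"
    unfolding sorted_wrt_map
    by (rule sorted_wrt_mono_rel[OF _ distinct_sorted_wrt[THEN iffD1, OF as(1)]])
      (auto intro!: coprime_min_real_poly)
  moreover have "coprime (min_real_poly z) [:0, 0, 1:]" if "z \<in> set us" for z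
    by (rule coprime_if_no_common_root)
      (use that us(2) in \<open>auto simp: X2 cpoly_min_real_poly simp del: map_poly_pCons\<close>)
  moreover have "coprime [:0, 0, 1:] (min_real_poly (of_real a))" if "a \<in> set \<alpha>s" for a
    by (rule coprime_if_no_common_root)
      (use that as(2) in \<open>auto simp: X2 cpoly_min_real_poly nonzero_real_eigenvalues_def\<close>)
  moreover have "coprime (min_real_poly z) (min_real_poly (of_real a))" if "z \<in> set us" for z a
    by (rule coprime_min_real_poly) (use that us(2) in auto)
  ultimately show "sorted_wrt coprime (primary_factors us \<alpha>s)"
    unfolding primary_factors_def by (auto simp: sorted_wrt_append)
  have dvd: "p dvd prod_list (primary_factors us \<alpha>s)" if "p \<in> set (primary_factors us \<alpha>s)" for p
    using that by (rule prod_list_dvd)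
  show "poly_endo T (prod_list (primary_factors us \<alpha>s)) v = 0"
  proof (rule annihilated_by_eigenvalues)
    show X: "[:0, 0, 1:] dvd prod_list (primary_factors us \<alpha>s)"
      by (rule dvd) (simp add: primary_factors_def)
    fix z assume z: "z \<in> eigenvalues T"
    consider "z = 0" | "z \<noteq> 0" "Im z = 0" | "Im z > 0" | "Im z < 0" by linarith
    then show "min_real_poly z dvd prod_list (primary_factors us \<alpha>s)"
    proof cases
      case 1
      have "[:0, 1:] dvd [:0, 0, 1 :: real:]" by (rule dvdI[of _ _ "[:0, 1:]"]) simp
      then show ?thesis using 1 X dvd_trans by (auto simp: min_real_poly_0)
    next
      case 2
      then obtain a where a: "z = of_real a" by (metis complex_is_Real_iff Reals_cases)
      then have "a \<in> set \<alpha>s"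
        using 2 z as(2) by (auto simp: nonzero_real_eigenvalues_def)
      then show ?thesis
        unfolding a by (intro dvd) (auto simp: primary_factors_def)
    next
      case 3
      then show ?thesis using z us(2) by (intro dvd) (auto simp: primary_factors_def)
    next
      case 4
      then have "cnj z \<in> set us" using cnj_eigenvalue[OF linear_T z] us(2) by simp
      then have "min_real_poly (cnj z) dvd prod_list (primary_factors us \<alpha>s)"
        by (intro dvd) (auto simp: primary_factors_def)
      then show ?thesis by (simp add: min_real_poly_cnj)
    qed
  qed
qed

end

section \<open>Non-real eigenvalues in index two\<close>

lemma two_equations_in_three_unknowns:
  fixes p1 p2 p3 q1 q2 q3 :: real
  obtains a b c where "a * p1 + b * p2 + c * p3 = 0" "a * q1 + b * q2 + c * q3 = 0"
    "a \<noteq> 0 \<or> b \<noteq> 0 \<or> c \<noteq> 0"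
proof -
  let ?x = "p2 * q3 - p3 * q2" and ?y = "p3 * q1 - p1 * q3" and ?z = "p1 * q2 - p2 * q1"
  consider "?x \<noteq> 0 \<or> ?y \<noteq> 0 \<or> ?z \<noteq> 0" | "?z = 0" "p1 \<noteq> 0 \<or> p2 \<noteq> 0"
    | "?z = 0" "p1 = 0" "p2 = 0" "q1 \<noteq> 0 \<or> q2 \<noteq> 0" | "p1 = 0" "p2 = 0" "q1 = 0" "q2 = 0"
    by blast
  then show ?thesis
  proof cases
    case 1
    then show ?thesis by (intro that[of ?x ?y ?z]) (auto simp: algebra_simps)
  next
    case 2
    then show ?thesis by (intro that[of p2 "- p1" 0]) (auto simp: algebra_simps)
  next
    case 3
    then show ?thesis by (intro that[of q2 "- q1" 0]) (auto simp: algebra_simps)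
  next
    case 4
    then show ?thesis by (intro that[of 1 0 0]) auto
  qed
qed

context pseudo_orthonormal
begin

lemma orthogonal_imp_independent:
  assumes fin: "finite S" and orth: "\<And>x y. x \<in> S \<Longrightarrow> y \<in> S \<Longrightarrow> x \<noteq> y \<Longrightarrow> g x y = 0"
    and nonnull: "\<And>x. x \<in> S \<Longrightarrow> g x x \<noteq> 0"
  shows "independent S"
proof (rule independent_if_scalars_zero[OF fin])
  fix c x assume s: "(\<Sum>y\<in>S. c y *\<^sub>R y) = 0" and x: "x \<in> S"
  have "0 = g (\<Sum>y\<in>S. c y *\<^sub>R y) x" using s by (simp add: g_simps)
  also have "\<dots> = (\<Sum>y\<in>S. if y = x then c x * g x x else 0)"
    unfolding g_sum_left using x orth by (intro sum.cong) (auto simp: g_simps)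
  also have "\<dots> = c x * g x x" using fin x by simp
  finally show "c x = 0" using nonnull[OF x] by simp
qed

text \<open>If \<open>x\<close> had negative square, then \<open>v, v', x\<close> would span a negative definite space of dimension three.
Two linear conditions make a non-zero vector of it orthogonal to the two negative basis vectors, so
that its square is non-negative.\<close>

lemma complement_of_two_negative_nonneg:
  assumes pos: "\<And>i. 2 \<le> i \<Longrightarrow> i < N \<Longrightarrow> \<epsilon> i = 1"
    and v: "g v v = - 1" "g v' v' = - 1" "g v v' = 0"
    and x: "g x v = 0" "g x v' = 0"
  shows "g x x \<ge> 0"
proof (rule ccontr)
  assume neg: "\<not> g x x \<ge> 0"
  obtain a b c where abc: "a * g v (e 0) + b * g v' (e 0) + c * g x (e 0) = 0"
      "a * g v (e 1) + b * g v' (e 1) + c * g x (e 1) = 0" "a \<noteq> 0 \<or> b \<noteq> 0 \<or> c \<noteq> 0"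
    using two_equations_in_three_unknowns by blast
  define y where "y = a *\<^sub>R v + b *\<^sub>R v' + c *\<^sub>R x"
  have y01: "g y (e 0) = 0" "g y (e 1) = 0"
    using abc by (simp_all add: y_def g_simps)
  have "g y y = g y (\<Sum>i<N. (\<epsilon> i * g y (e i)) *\<^sub>R e i)" unfolding expand[symmetric] ..
  also have "\<dots> = (\<Sum>i<N. \<epsilon> i * (g y (e i))\<^sup>2)"
    by (simp add: g_sum_right g_simps power2_eq_square mult.assoc)
  also have "\<dots> \<ge> 0"
  proof (rule sum_nonneg)
    fix i assume "i \<in> {..<N}"
    then consider "i = 0" | "i = 1" | "\<epsilon> i = 1" using pos[of i] by fastforce
    then show "\<epsilon> i * (g y (e i))\<^sup>2 \<ge> 0" using y01 by cases auto
  qed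
  finally have "g y y \<ge> 0" .
  moreover have "g y y = c\<^sup>2 * g x x - a\<^sup>2 - b\<^sup>2"
    using v x sym[of v' v] sym[of v x] sym[of v' x]
    by (simp add: y_def g_simps power2_eq_square algebra_simps)
  moreover have "c\<^sup>2 * g x x \<le> 0" using neg by (simp add: mult_le_0_iff)
  moreover have "a\<^sup>2 \<ge> 0" "b\<^sup>2 \<ge> 0" by simp_all
  ultimately have "a\<^sup>2 = 0" "b\<^sup>2 = 0" "c\<^sup>2 * g x x = 0" by linarith+
  then show False using abc(3) neg by auto
qed

text \<open>A null vector \<open>x\<close> in a space without negative vectors is orthogonal to that space: otherwise adding a
large multiple of \<open>x\<close> to a vector not orthogonal to it would produce a negative square.\<close>

lemma complement_of_two_negative_pos:
  assumes pos: "\<And>i. 2 \<le> i \<Longrightarrow> i < N \<Longrightarrow> \<epsilon> i = 1"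
    and v: "g v v = - 1" "g v' v' = - 1" "g v v' = 0"
    and x: "g x v = 0" "g x v' = 0" "x \<noteq> 0"
  shows "g x x > 0"
proof -
  note nonneg = complement_of_two_negative_nonneg[OF pos v]
  have "g x x \<noteq> 0"
  proof
    assume null: "g x x = 0"
    obtain y where y: "g x y \<noteq> 0" using nondegenerate x(3) by blast
    define y' where "y' = y + g y v *\<^sub>R v + g y v' *\<^sub>R v'"
    have y': "g y' v = 0" "g y' v' = 0" "g x y' = g x y"
      using v x sym[of v' v] by (simp_all add: y'_def g_simps)
    \<comment> \<open>Chosen to make the square of \<open>t x + y'\<close> equal to \<open>-1\<close>.\<close>
    define t where "t = - (g y' y' + 1) / (2 * g x y)"
    have t: "t * g x y = - (g y' y' + 1) / 2" using y by (simp add: t_def)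
    have "g (t *\<^sub>R x + y') (t *\<^sub>R x + y') \<ge> 0"
      by (rule nonneg) (simp_all add: g_simps x y')
    also have "g (t *\<^sub>R x + y') (t *\<^sub>R x + y') = 2 * (t * g x y) + g y' y'"
      using null y'(3) sym[of y' x] by (simp add: g_simps)
    also have "\<dots> = - 1" by (simp add: t)
    finally show False by simp
  qed
  moreover have "g x x \<ge> 0" by (rule nonneg) (use x in auto)
  ultimately show ?thesis by simp
qed

text \<open>For a self-adjoint \<open>J\<close> this says that \<open>J\<close> is a complex structure on \<open>S\<close> and that the complex symmetric form
\<open>h x y = g x y - \<i> g x (J y)\<close>, which is complex bilinear, is nondegenerate on \<open>S\<close>.\<close>

definition complex_nondegenerate :: "('a \<Rightarrow> 'a) \<Rightarrow> 'a set \<Rightarrow> bool" where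
  "complex_nondegenerate J S \<longleftrightarrow> subspace S \<and> (\<forall>x\<in>S. J x \<in> S \<and> J (J x) = - x) \<and>
    (\<forall>x\<in>S. x \<noteq> 0 \<longrightarrow> (\<exists>y\<in>S. g x y \<noteq> 0))"

text \<open>By polarization there is \<open>v\<close> with \<open>g v v \<noteq> 0\<close>, hence with \<open>h v v \<noteq> 0\<close> for the complex form \<open>h\<close>. Multiplying
\<open>v\<close> by a complex square root \<open>c\<close> of \<open>-1 / h v v\<close> gives \<open>h w w = -1\<close>, whose real and imaginary parts are
the two claims.\<close>

lemma complex_unit_vector:
  assumes J: "linear J" "\<And>x y. g (J x) y = g x (J y)" and S: "complex_nondegenerate J S"
    and x: "x \<in> S" "x \<noteq> 0"
  obtains w where "w \<in> S" "g w w = - 1" "g w (J w) = 0"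
proof -
  have sub: "subspace S" and JS: "\<And>x. x \<in> S \<Longrightarrow> J x \<in> S" "\<And>x. x \<in> S \<Longrightarrow> J (J x) = - x"
    using S unfolding complex_nondegenerate_def by blast+
  obtain y where y: "y \<in> S" "g x y \<noteq> 0" using S x unfolding complex_nondegenerate_def by blast
  have "g (x + y) (x + y) = g x x + 2 * g x y + g y y"
    using sym[of y x] by (simp add: g_simps)
  then have "g x x \<noteq> 0 \<or> g y y \<noteq> 0 \<or> g (x + y) (x + y) \<noteq> 0" using y by auto
  then obtain v where v: "v \<in> S" "g v v \<noteq> 0"
    using x y subspace_add[OF sub] by metis
  define A where "A = g v v"
  define B where "B = g v (J v)"
  have B': "g (J v) v = B" using J(2) by (simp add: B_def)
  have JJ: "g (J v) (J v) = - A" using J(2) JS(2)[OF v(1)] by (simp add: A_def g_simps)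
  define c where "c = csqrt (- 1 / Complex A (- B))"
  have "Complex A (- B) \<noteq> 0" using v(2) by (simp add: A_def complex_eq_iff)
  then have "c\<^sup>2 * Complex A (- B) = - 1" by (simp add: c_def)
  then have c: "((Re c)\<^sup>2 - (Im c)\<^sup>2) * A + 2 * Re c * Im c * B = - 1"
      "2 * Re c * Im c * A - ((Re c)\<^sup>2 - (Im c)\<^sup>2) * B = 0"
    by (auto simp: complex_eq_iff power2_eq_square algebra_simps)
  define w where "w = Re c *\<^sub>R v + Im c *\<^sub>R J v"
  have Jw: "J w = Re c *\<^sub>R J v - Im c *\<^sub>R v"
    using JS(2)[OF v(1)] by (simp add: w_def linear_add[OF J(1)] linear_scale[OF J(1)])
  have "g w w = - 1"
    using c(1) by (simp add: w_def g_simps JJ B' flip: A_def B_def) (simp add: algebra_simps power2_eq_square)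
  moreover have "g w (J w) = 0"
    unfolding Jw using c(2)
    by (simp add: w_def g_simps JJ B' flip: A_def B_def) (simp add: algebra_simps power2_eq_square)
  moreover have "w \<in> S"
    using v JS sub by (auto simp: w_def intro!: subspace_add subspace_scale)
  ultimately show ?thesis using that by blast
qed

text \<open>The complement of a unit vector in the complex sense. Since \<open>g (J w) (J w) = 1\<close>, the projection formula
subtracts the components along \<open>w\<close> and \<open>J w\<close> with opposite signs.\<close>

lemma complex_nondegenerate_complement:
  assumes J: "linear J" "\<And>x y. g (J x) y = g x (J y)" and S: "complex_nondegenerate J S"
    and w: "w \<in> S" "g w w = - 1" "g w (J w) = 0"
  defines "S' \<equiv> {x \<in> S. g x w = 0 \<and> g x (J w) = 0}"
  shows "complex_nondegenerate J S'"
    and "y \<in> S \<Longrightarrow> y + g y w *\<^sub>R w - g y (J w) *\<^sub>R J w \<in> S'"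
proof -
  have sub: "subspace S" and JS: "\<And>x. x \<in> S \<Longrightarrow> J x \<in> S" "\<And>x. x \<in> S \<Longrightarrow> J (J x) = - x"
    using S unfolding complex_nondegenerate_def by blast+
  have JJ: "g (J w) (J w) = 1" using J(2) JS(2)[OF w(1)] w(2) by (simp add: g_simps)
  have proj: "y + g y w *\<^sub>R w - g y (J w) *\<^sub>R J w \<in> S'" if "y \<in> S" for y
    using that w JS sub JJ sym[of "J w" w]
    by (auto simp: S'_def g_simps intro!: subspace_add subspace_diff subspace_scale)
  then show "y \<in> S \<Longrightarrow> y + g y w *\<^sub>R w - g y (J w) *\<^sub>R J w \<in> S'" .
  have "subspace S'"
    using sub by (auto simp: S'_def subspace_def g_simps)
  moreover have "J x \<in> S'" if "x \<in> S'" for x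
    using that JS w by (auto simp: S'_def J(2) g_simps)
  moreover have "\<exists>y\<in>S'. g x y \<noteq> 0" if x: "x \<in> S'" "x \<noteq> 0" for x
  proof -
    obtain y where y: "y \<in> S" "g x y \<noteq> 0"
      using S x unfolding complex_nondegenerate_def S'_def by blast
    then show ?thesis
      using x by (intro bexI[OF _ proj[OF y(1)]]) (auto simp: S'_def g_simps)
  qed
  ultimately show "complex_nondegenerate J S'"
    using JS unfolding complex_nondegenerate_def by (auto simp: S'_def)
qed

end

text \<open>A complex unit vector \<open>v\<close> exists in \<open>V\<close>, and the point is to find a second one. If \<open>V\<close> were spanned by \<open>v\<close> and
\<open>J v\<close>, then \<open>R v a\<close> would be zero for all \<open>a\<close>: for \<open>a\<close> orthogonal to \<open>V\<close> because the curvature endomorphisms preserve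
\<open>V\<close>, for \<open>a = J v\<close> because \<open>R v (J v) = J \<circ> R v v\<close>. Thus \<open>T v = 0\<close>, contradicting that zero is not a root of
the minimal polynomial of \<open>z\<close>. After splitting off a second unit vector \<open>v'\<close> nothing remains, since a third one
would be a vector of square \<open>-1\<close> orthogonal to \<open>v\<close> and \<open>v'\<close>.\<close>

lemma (in semi_symmetric) nonreal_eigenvalue_kernel:
  assumes pos: "\<And>i. 2 \<le> i \<Longrightarrow> i < N \<Longrightarrow> \<epsilon> i = 1"
    and z: "z \<in> eigenvalues T" "Im z > 0"
  defines "V \<equiv> {x. poly_endo T (min_real_poly z) x = 0}"
  obtains v v' where "v \<in> V" "v' \<in> V" "g v v = - 1" "g v' v' = - 1" "g v v' = 0" "dim V = 4"
proof -
  let ?q = "poly_endo T (min_real_poly z)"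
  have q: "?q x = T (T x) - (2 * Re z) *\<^sub>R T x + (cmod z)\<^sup>2 *\<^sub>R x" for x
    using z(2) by (auto simp: poly_endo_min_real_poly[OF linear_T] complex_is_Real_iff)
  define J where "J x = (1 / Im z) *\<^sub>R (T x - Re z *\<^sub>R x)" for x
  have J: "linear J" "\<And>x y. g (J x) y = g x (J y)"
    by (auto simp: J_def linear_iff linear_add[OF linear_T] linear_scale[OF linear_T] algebra_simps
        g_simps T_self_adjoint)
  have T_J: "T x = Re z *\<^sub>R x + Im z *\<^sub>R J x" for x
    using z(2) by (simp add: J_def)
  have qT: "?q (T x) = T (?q x)" for x by (rule poly_endo_commute[OF linear_T])
  have sub: "subspace V"
    using linear_subspace_vimage[OF linear_poly_endo[OF linear_T] subspace_single_0]
    by (simp add: V_def vimage_def)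
  have JV: "J x \<in> V" if "x \<in> V" for x
  proof -
    have "T x \<in> V" using that qT by (simp add: V_def linear_0[OF linear_T])
    then show ?thesis
      unfolding J_def using that sub by (auto intro!: subspace_scale subspace_diff)
  qed
  have JJ: "J (J x) = - x" if "x \<in> V" for x
  proof -
    have "T (T x) = (2 * Re z) *\<^sub>R T x - ((Re z)\<^sup>2 + (Im z)\<^sup>2) *\<^sub>R x"
      using that q[of x] by (simp add: V_def cmod_power2 algebra_simps)
    also have "\<dots> = Re z *\<^sub>R T x + Re z *\<^sub>R T x - (Re z * Re z + Im z * Im z) *\<^sub>R x"
      by (simp add: power2_eq_square flip: scaleR_left_distrib)
    finally have "T (T x - Re z *\<^sub>R x) - Re z *\<^sub>R (T x - Re z *\<^sub>R x) = - (Im z * Im z) *\<^sub>R x"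
      by (simp add: linear_diff[OF linear_T] linear_scale[OF linear_T] algebra_simps)
    moreover have "J (J x) = (1 / (Im z * Im z)) *\<^sub>R
        (T (T x - Re z *\<^sub>R x) - Re z *\<^sub>R (T x - Re z *\<^sub>R x))"
      by (simp add: J_def linear_diff[OF linear_T] linear_scale[OF linear_T] algebra_simps)
    ultimately show ?thesis using z(2) by simp
  qed
  have nondeg: "\<exists>y\<in>V. g x y \<noteq> 0" if x: "x \<in> V" "x \<noteq> 0" for x
  proof -
    have finE: "finite (eigenvalues T)" by (rule finite_eigenvalues[OF linear_T])
    then obtain us where us: "distinct us" "set us = {w \<in> eigenvalues T. Im w > 0} - {z}"
      using finite_distinct_list[of "{w \<in> eigenvalues T. Im w > 0} - {z}"] by auto
    have "nonzero_real_eigenvalues T \<subseteq> Re ` eigenvalues T"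
      by (force simp: nonzero_real_eigenvalues_def)
    then obtain as where as: "distinct as" "set as = nonzero_real_eigenvalues T"
      using finite_distinct_list[OF finite_subset[OF _ finite_imageI[OF finE]]] by metis
    have zus: "distinct (z # us)" "set (z # us) = {w \<in> eigenvalues T. Im w > 0}"
      using us z by auto
    have "primary_factors (z # us) as = min_real_poly z # primary_factors us as"
      by (simp add: primary_factors_def)
    then have "coprime (min_real_poly z) (prod_list (primary_factors us as))"
        "\<And>v. poly_endo T (min_real_poly z * prod_list (primary_factors us as)) v = 0"
      using primary_factors[OF zus as] by (auto intro: prod_list_coprime_right)
    then show ?thesis
      using coprime_kernel_nondegenerate[OF linear_T T_self_adjoint] x unfolding V_def by blast
  qed
  have V: "complex_nondegenerate J V"
    using sub JV JJ nondeg by (simp add: complex_nondegenerate_def)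
  obtain x where "x \<in> V" "x \<noteq> 0" using z(1) eigenvalues_iff[OF linear_T] by (auto simp: V_def)
  then obtain v where v: "v \<in> V" "g v v = - 1" "g v (J v) = 0"
    using complex_unit_vector[OF J V] by blast
  have Jv: "g (J v) (J v) = 1" using J(2) JJ[OF v(1)] v(2) by (simp add: g_simps)
  define V' where "V' = {x \<in> V. g x v = 0 \<and> g x (J v) = 0}"
  have V': "complex_nondegenerate J V'"
      "\<And>y. y \<in> V \<Longrightarrow> y + g y v *\<^sub>R v - g y (J v) *\<^sub>R J v \<in> V'"
    unfolding V'_def using complex_nondegenerate_complement[OF J V v] by blast+
  have "\<exists>x\<in>V'. x \<noteq> 0"
  proof (rule ccontr)
    assume "\<not> ?thesis"
    then have proj0: "y + g y v *\<^sub>R v - g y (J v) *\<^sub>R J v = 0" if "y \<in> V" for y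
      using V'(2)[OF that] by blast
    have V_span: "y = g y (J v) *\<^sub>R J v - g y v *\<^sub>R v" if "y \<in> V" for y
      using proj0[OF that] by (simp add: algebra_simps)
    have Rv_orth: "R v a x = 0" if a: "g a v = 0" "g a (J v) = 0" for a x
    proof (rule nondegenerate)
      fix y
      have "R x y v \<in> V"
        using v(1) symmetric_intertwiner_poly[of "min_real_poly z"]
        by (simp add: V_def symmetric_intertwiner_def linear_0[OF linear_R])
      then have "g (R x y v) a = 0"
        using a sym[of a] by (subst V_span) (simp_all add: g_simps)
      then show "g (R v a x) y = 0" by (simp add: R_pair_sym)
    qed
    have "symmetric_intertwiner T"
      by (simp add: symmetric_intertwiner_def linear_T T_self_adjoint T_commutes_with_R)
    then have RvJ: "R v (J v) x = 0" for x
      by (simp add: J_def linear_scale[OF linear_R2] linear_diff[OF linear_R2] R_self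
          R_intertwiner(2) linear_0[OF linear_T])
    have "R v a x = 0" for a x
    proof -
      define a' where "a' = a + g a v *\<^sub>R v - g a (J v) *\<^sub>R J v"
      have "R v a' x = 0"
        by (rule Rv_orth) (use v Jv sym[of "J v" v] in \<open>simp_all add: a'_def g_simps\<close>)
      then show ?thesis
        by (simp add: a'_def linear_diff[OF linear_R2] linear_add[OF linear_R2] linear_scale[OF linear_R2]
            R_self RvJ)
    qed
    then have "g (T v) y = 0" for y
      by (simp add: g_T_eq_ric ric_def trace_formula linear_zero g_simps)
    then have "T v = 0" by (rule nondegenerate)
    then have "(cmod z)\<^sup>2 *\<^sub>R v = 0"
      using q[of v] v(1) by (simp add: V_def linear_0[OF linear_T])
    moreover have "z \<noteq> 0" "v \<noteq> 0" using z(2) v(2) by (auto simp: g_simps)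
    ultimately show False by simp
  qed
  then obtain v' where v': "v' \<in> V'" "g v' v' = - 1" "g v' (J v') = 0"
    using complex_unit_vector[OF J V'(1)] by blast
  define V'' where "V'' = {x \<in> V'. g x v' = 0 \<and> g x (J v') = 0}"
  have V'': "complex_nondegenerate J V''"
      "\<And>y. y \<in> V' \<Longrightarrow> y + g y v' *\<^sub>R v' - g y (J v') *\<^sub>R J v' \<in> V''"
    unfolding V''_def using complex_nondegenerate_complement[OF J V'(1) v'] by blast+
  have v'V: "v' \<in> V" "g v' v = 0" "g v' (J v) = 0" using v'(1) by (auto simp: V'_def)
  have vv': "g v v' = 0" "g (J v) v' = 0" using v'V(2,3) sym by metis+
  have vJv': "g v (J v') = 0" using vv'(2) J(2)[of v v'] by simp
  have JvJv': "g (J v) (J v') = 0" "g (J v') (J v') = 1"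
    using vv'(1) v'(2) JJ[OF v'V(1)] by (simp_all add: J(2) g_simps)
  have V''_0: "x = 0" if x: "x \<in> V''" for x
  proof (rule ccontr)
    assume "x \<noteq> 0"
    then obtain w where w: "w \<in> V''" "g w w = - 1"
      using complex_unit_vector[OF J V''(1) x] by blast
    then have "g w v = 0" "g w v' = 0" by (auto simp: V'_def V''_def)
    then show False
      using complement_of_two_negative_nonneg[OF pos v(2) v'(2) vv'(1)] w(2) by force
  qed
  let ?B = "{v, J v, v', J v'}"
  have gB: "g v' v = 0" "g (J v) v = 0" "g (J v') v = 0" "g (J v') (J v) = 0" "g (J v') v' = 0" "g v' (J v) = 0"
    using v(3) v'(3) v'V(2,3) vJv' JvJv' sym by metis+
  have distinct: "v \<noteq> J v" "v \<noteq> v'" "v \<noteq> J v'" "J v \<noteq> v'" "J v \<noteq> J v'" "v' \<noteq> J v'"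
    using v v' vv' vJv' JvJv' Jv by auto
  have "dim V = card ?B"
  proof (rule dim_unique[of ?B])
    show "?B \<subseteq> V" using v(1) v'V(1) JV by auto
    show "V \<subseteq> span ?B"
    proof
      fix y assume "y \<in> V"
      define y1 where "y1 = y + g y v *\<^sub>R v - g y (J v) *\<^sub>R J v"
      define y2 where "y2 = y1 + g y1 v' *\<^sub>R v' - g y1 (J v') *\<^sub>R J v'"
      have "y2 = 0" unfolding y2_def by (rule V''_0, rule V''(2)) (use V'(2) \<open>y \<in> V\<close> y1_def in auto)
      then have "y1 = g y1 (J v') *\<^sub>R J v' - g y1 v' *\<^sub>R v'"
        unfolding y2_def by (simp add: algebra_simps)
      then have "y1 \<in> span ?B" 
        by (metis insertCI span_base span_diff span_scale)
      moreover have "y = y1 + g y (J v) *\<^sub>R J v - g y v *\<^sub>R v" by (simp add: y1_def)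
      ultimately show "y \<in> span ?B"
        by (metis insertCI span_base span_diff span_scale span_add)
    qed
    show "independent ?B"
      by (rule orthogonal_imp_independent) (use v v' vv' vJv' JvJv' Jv gB in auto)
  qed simp
  also have "card ?B = 4" using distinct by simp
  finally show ?thesis using that[OF v(1) v'V(1) v(2) v'(2) vv'(1)] by blast
qed

section \<open>The splitting in signature (2, n)\<close>

theorem proposition2p2:
  fixes g :: "'a::real_vector \<Rightarrow> 'a \<Rightarrow> real"
    and K :: "('a \<Rightarrow> 'a) \<Rightarrow> ('a \<Rightarrow> 'a)"
    and n :: nat
  assumes "n \<ge> 2"
    and "metric_of_signature 2 n g"
    and "semi_symmetric_on g UNIV K"
  shows "finite (nonreal_eigenvalues (Ric g K)) \<and> card (nonreal_eigenvalues (Ric g K)) \<le> 2 \<and>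
    (\<forall>\<alpha>s. distinct \<alpha>s \<and> set \<alpha>s = nonzero_real_eigenvalues (Ric g K) \<longrightarrow>
      (\<exists>z Vc V\<^sub>0.
         z \<notin> \<real> \<and> nonreal_eigenvalues (Ric g K) = {z, cnj z} \<and>
         V\<^sub>0 = {v. Ric g K v = 0} \<and>
         Vc = {v. Ric g K (Ric g K v) - Re (z + cnj z) *\<^sub>R Ric g K v + (cmod z)\<^sup>2 *\<^sub>R v = 0} \<and>
         splits_orthogonally g (Vc # V\<^sub>0 # map (eigenspace (Ric g K)) \<alpha>s) \<and>
         dim Vc = 4 \<and>
         (\<forall>W \<in> set (V\<^sub>0 # map (eigenspace (Ric g K)) \<alpha>s).
            positive_definite_on g W \<and> semi_symmetric_on g W K))
      \<or>
      (eigenvalues (Ric g K) \<subseteq> \<real> \<and>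
       splits_orthogonally g
         ({v. Ric g K (Ric g K v) = 0} # map (eigenspace (Ric g K)) \<alpha>s)))"
proof -
  obtain e :: "nat \<Rightarrow> 'a" where e: "bilinear g" "\<And>u v. g u v = g v u" "span (e ` {..<2 + n}) = UNIV"
      "\<And>i j. i < 2 + n \<Longrightarrow> j < 2 + n \<Longrightarrow>
        g (e i) (e j) = (if i \<noteq> j then 0 else if i < 2 then - 1 else 1)"
    using assms(2) unfolding metric_of_signature_def by blast
  interpret semi_symmetric g e "2 + n" "\<lambda>i. if i < 2 then - 1 else 1" K
    using e assms(3) by unfold_locales auto
  let ?ker = "\<lambda>p. {v. poly_endo T p v = 0}"
  have finite: "finite (eigenvalues T)" by (rule finite_eigenvalues[OF linear_T])
  then have fin: "finite (nonreal_eigenvalues T)" by (simp add: nonreal_eigenvalues_def)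
  have ker_X2: "?ker [:0, 0, 1:] = {v. T (T v) = 0}" by (simp add: poly_endo_X2[OF linear_T])
  have ker_real: "?ker (min_real_poly (of_real a)) = eigenspace T a" for a
    by (rule kernel_min_real_poly_of_real[OF linear_T])
  show ?thesis
  proof (cases "eigenvalues T \<subseteq> \<real>")
    case True
    then have "nonreal_eigenvalues T = {}" by (auto simp: nonreal_eigenvalues_def)
    moreover have "splits_orthogonally g ({v. T (T v) = 0} # map (eigenspace T) \<alpha>s)"
      if as: "distinct \<alpha>s" "set \<alpha>s = nonzero_real_eigenvalues T" for \<alpha>s
    proof -
      have us: "distinct []" "set [] = {z \<in> eigenvalues T. Im z > 0}"
        using True by (auto simp: complex_is_Real_iff)
      have "splits_orthogonally g (map ?ker (primary_factors [] \<alpha>s))"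
        by (intro splits_orthogonally_kernels linear_T T_self_adjoint primary_factors[OF us as])
      then show ?thesis by (simp add: primary_factors_def ker_X2 ker_real o_def)
    qed
    ultimately show ?thesis using True by simp
  next
    case False
    then obtain z' where z': "z' \<in> eigenvalues T" "Im z' \<noteq> 0"
      unfolding complex_is_Real_iff subset_iff by blast
    \<comment> \<open>The kernels are indexed by the eigenvalues in the upper half plane.\<close>
    define z where "z = (if Im z' > 0 then z' else cnj z')"
    have z: "z \<in> eigenvalues T" "Im z > 0"
      using z' cnj_eigenvalue[OF linear_T z'(1)] by (auto simp: z_def)
    define Vc where "Vc = ?ker (min_real_poly z)"
    obtain v v' where v: "v \<in> Vc" "v' \<in> Vc" "g v v = - 1" "g v' v' = - 1" "g v v' = 0" "dim Vc = 4"
      using nonreal_eigenvalue_kernel[OF _ z] unfolding Vc_def by auto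
    have pos: "positive_definite_on g (?ker p)" if p: "coprime p (min_real_poly z)" for p
    proof -
      have "g x v = 0" "g x v' = 0" if "x \<in> ?ker p" for x
        using coprime_kernels_orthogonal[OF linear_T T_self_adjoint p] that v(1,2)
        by (auto simp: Vc_def)
      then show ?thesis
        unfolding positive_definite_on_def
        using complement_of_two_negative_pos[OF _ v(3,4,5)] by simp
    qed
    \<comment> \<open>The kernel of a second pair would be orthogonal to \<open>Vc\<close> and hence positive definite, but it contains
        a vector of square \<open>-1\<close> itself.\<close>
    have upper: "{w \<in> eigenvalues T. Im w > 0} = {z}"
    proof -
      have "w = z" if w: "w \<in> eigenvalues T" "Im w > 0" for w
      proof (rule ccontr)
        assume "w \<noteq> z"
        then have "coprime (min_real_poly w) (min_real_poly z)"
          using w z by (intro coprime_min_real_poly) auto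
        then have "positive_definite_on g (?ker (min_real_poly w))" by (rule pos)
        moreover obtain x where "x \<in> ?ker (min_real_poly w)" "g x x = - 1"
          using nonreal_eigenvalue_kernel[OF _ w] by auto
        moreover have "x \<noteq> 0" using \<open>g x x = - 1\<close> by (auto simp: g_simps)
        ultimately show False by (auto simp: positive_definite_on_def)
      qed
      then show ?thesis using z by blast
    qed
    have nonreal: "nonreal_eigenvalues T = {z, cnj z}"
    proof -
      have "w = z \<or> w = cnj z" if w: "w \<in> eigenvalues T" "Im w \<noteq> 0" for w
      proof (cases "Im w > 0")
        case True
        then show ?thesis using upper w(1) by blast
      next
        case False
        then have "cnj w \<in> {w \<in> eigenvalues T. Im w > 0}"
          using cnj_eigenvalue[OF linear_T w(1)] w(2) by auto
        then have "cnj w = z" using upper by blast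
        then show ?thesis by (metis complex_cnj_cnj)
      qed
      moreover have "z \<in> nonreal_eigenvalues T" "cnj z \<in> nonreal_eigenvalues T"
        using z cnj_eigenvalue[OF linear_T z(1)]
        by (auto simp: nonreal_eigenvalues_def complex_is_Real_iff)
      ultimately show ?thesis
        unfolding nonreal_eigenvalues_def complex_is_Real_iff by blast
    qed
    have "z \<notin> \<real>" using z(2) by (simp add: complex_is_Real_iff)
    then have Vc: "Vc = {v. T (T v) - Re (z + cnj z) *\<^sub>R T v + (cmod z)\<^sup>2 *\<^sub>R v = 0}"
      by (simp add: Vc_def poly_endo_min_real_poly[OF linear_T])
    have "coprime [:0, 0, 1:] (min_real_poly z)"
      by (rule coprime_if_no_common_root)
        (use z in \<open>auto simp: cpoly_min_real_poly map_poly_pCons\<close>)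
    then have pos0: "positive_definite_on g {v. T (T v) = 0}"
      using pos ker_X2 by metis
    have ker_T: "{v. T (T v) = 0} = {v. T v = 0}"
    proof -
      have "T x = 0" if x: "T (T x) = 0" for x
      proof (rule ccontr)
        assume "T x \<noteq> 0"
        moreover have "T (T (T x)) = 0" using x linear_0[OF linear_T] by simp
        ultimately have "g (T x) (T x) > 0" using pos0 by (auto simp: positive_definite_on_def)
        also have "g (T x) (T x) = g x (T (T x))" by (rule T_self_adjoint)
        finally show False using x by (simp add: g_simps)
      qed
      then show ?thesis using linear_0[OF linear_T] by auto
    qed
    have split: "splits_orthogonally g (Vc # {v. T v = 0} # map (eigenspace T) \<alpha>s) \<and>
        (\<forall>W \<in> set ({v. T v = 0} # map (eigenspace T) \<alpha>s).
          positive_definite_on g W \<and> semi_symmetric_on g W K)"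
      if as: "distinct \<alpha>s" "set \<alpha>s = nonzero_real_eigenvalues T" for \<alpha>s
    proof -
      have us: "distinct [z]" "set [z] = {z \<in> eigenvalues T. Im z > 0}" using upper by auto
      note factors = primary_factors[OF us as]
      let ?ps = "primary_factors [z] \<alpha>s"
      have "splits_orthogonally g (map ?ker ?ps)"
        by (intro splits_orthogonally_kernels linear_T T_self_adjoint factors)
      moreover have kers: "map ?ker ?ps = Vc # {v. T v = 0} # map (eigenspace T) \<alpha>s"
        by (simp add: primary_factors_def ker_X2 ker_real o_def ker_T Vc_def)
      moreover have "positive_definite_on g W \<and> semi_symmetric_on g W K"
        if W: "W \<in> set ({v. T v = 0} # map (eigenspace T) \<alpha>s)" for W
      proof -
        have "W \<in> set (tl (map ?ker ?ps))" unfolding kers using W by simp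
        then obtain p where p: "p \<in> set (tl ?ps)" "W = ?ker p" by (auto simp: map_tl[symmetric])
        obtain ps qs where ps_qs: "?ps = ps @ p # qs"
          using p(1) by (metis list.set_sel(2) split_list tl_Nil list.set(1) empty_iff)
        have "positive_definite_on g W"
          unfolding p(2)
        proof (rule pos)
          show "coprime p (min_real_poly z)"
            using p(1) factors(1) by (auto simp: primary_factors_def coprime_commute)
        qed
        moreover have "semi_symmetric_on g W K"
        proof -
          \<comment> \<open>The projection onto \<open>W\<close> is the polynomial \<open>b * ?r\<close> in \<open>T\<close> that the Bezout identity provides.\<close>
          let ?r = "prod_list ps * prod_list qs"
          have "coprime p ?r"
            using factors(1) unfolding ps_qs
            by (auto simp: sorted_wrt_append coprime_commute intro!: prod_list_coprime_right)
          then obtain a b where ab: "\<And>v. v = poly_endo T (a * p) v + poly_endo T (b * ?r) v"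
            using coprime_kernel_split[OF linear_T] by blast
          show ?thesis
          proof (rule semi_symmetric_on_range_of_intertwiner[OF symmetric_intertwiner_poly])
            fix x
            have "poly_endo T p (poly_endo T (b * ?r) x) = poly_endo T (b * prod_list ?ps) x"
              unfolding ps_qs by (simp add: ac_simps flip: poly_endo_mult[OF linear_T])
            then show "poly_endo T (b * ?r) x \<in> W"
              unfolding p(2) using poly_endo_mult_eq_0[OF linear_T factors(2)] by simp
          next
            fix x assume "x \<in> W"
            then show "poly_endo T (b * ?r) x = x"
              using ab[of x] poly_endo_mult_eq_0[OF linear_T, of p x a] p(2) by simp
          qed
        qed
        ultimately show ?thesis by blast
      qed
      ultimately show ?thesis by metis
    qed
    show ?thesis
    proof (intro conjI allI impI)
      show "finite (nonreal_eigenvalues T)" by (rule fin)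
      show "card (nonreal_eigenvalues T) \<le> 2"
        unfolding nonreal by (simp add: card_insert_if)
    next
      fix \<alpha>s assume "distinct \<alpha>s \<and> set \<alpha>s = nonzero_real_eigenvalues T"
      then show "(\<exists>z Vc V\<^sub>0.
         z \<notin> \<real> \<and> nonreal_eigenvalues T = {z, cnj z} \<and> V\<^sub>0 = {v. T v = 0} \<and>
         Vc = {v. T (T v) - Re (z + cnj z) *\<^sub>R T v + (cmod z)\<^sup>2 *\<^sub>R v = 0} \<and>
         splits_orthogonally g (Vc # V\<^sub>0 # map (eigenspace T) \<alpha>s) \<and> dim Vc = 4 \<and>
         (\<forall>W \<in> set (V\<^sub>0 # map (eigenspace T) \<alpha>s).
            positive_definite_on g W \<and> semi_symmetric_on g W K)) \<or>
        (eigenvalues T \<subseteq> \<real> \<and>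
         splits_orthogonally g ({v. T (T v) = 0} # map (eigenspace T) \<alpha>s))"
        using split[of \<alpha>s]
        by (intro disjI1 exI[of _ z] exI[of _ Vc] exI[of _ "{v. T v = 0}"] conjI
            \<open>z \<notin> \<real>\<close> nonreal Vc v(6) refl) blast+
    qed
  qed
qed

end
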